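(* Let $n\in\mathbb N_0$, $q\in\mathbb C$ with $0<|q|<1$, and let $a,b,c,d$ be non-zero complex numbers with $a,b,c,d\notin\{q^{-k}:k\in\mathbb N_0\}$. Then the moments $\mu_n$ of the Askey--Wilson polynomials can be given by $$\mu_n=\frac{(ab,ac,ad,bc,bd,cd;q)_\infty}{2^{n+1}(abcd;q)_\infty}\sum_{k=0}^n\binom nk\Big(F_k(a;b,c,d)+F_k(b;a,c,d)+F_k(c;b,a,d)+F_k(d;b,c,a)\Big),$$ where $$F_k(a;b,c,d):=\frac{(\frac1{a^2};q)_\infty\,a^{|n-2k|}}{(ab,ac,ad,\frac ba,\frac ca,\frac da;q)_\infty}\;{}_6W_5\!\left(a^2;ab,ac,ad;q,\frac{q^{1+|n-2k|}}{abcd}\right),$$ and where $a/b,a/c,a/d,b/c,b/d,c/d\notin\{q^k:k\in\mathbb Z\}$.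
   Context: Notation. $(a;q)_k=\prod_{j=0}^{k-1}(1-aq^j)$, $(a;q)_\infty=\prod_{j\ge0}(1-aq^j)$, and $(a_1,\dots,a_r;q)_k=\prod_j(a_j;q)_k$ for $k\in\mathbb N_0\cup\{\infty\}$. The basic hypergeometric series is ${}_{r+1}\phi_r(a_1,\dots,a_{r+1};b_1,\dots,b_r;q,z)=\sum_{k\ge0}\frac{(a_1,\dots,a_{r+1};q)_k}{(q,b_1,\dots,b_r;q)_k}z^k$, which (when nonterminating) converges for $|z|<1$. The very-well-poised series is $${}_{6}W_5(\alpha;\beta,\gamma,\delta;q,z)={}_6\phi_5\!\left(\alpha,q\sqrt\alpha,-q\sqrt\alpha,\beta,\gamma,\delta;\sqrt\alpha,-\sqrt\alpha,\tfrac{q\alpha}\beta,\tfrac{q\alpha}\gamma,\tfrac{q\alpha}\delta;q,z\right).$$ The moments of the Askey--Wilson polynomials are $$\mu_n=\frac{(q,ab,ac,ad,bc,bd,cd;q)_\infty}{4\pi\,(abcd;q)_\infty}\int_{-\pi}^{\pi}w(\theta)\cos^n\theta\,\mathrm d\theta,$$ $$w(\theta)=\frac{(\mathrm e^{2i\theta},\mathrm e^{-2i\theta};q)_\infty}{(a\mathrm e^{i\theta},a\mathrm e^{-i\theta},b\mathrm e^{i\theta},b\mathrm e^{-i\theta},c\mathrm e^{i\theta},c\mathrm e^{-i\theta},d\mathrm e^{i\theta},d\mathrm e^{-i\theta};q)_\infty},$$ normalized so that $\mu_0=1$.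
   Formalization: When not all parameters have modulus below 1, the moment integral is taken over a contour separating the poles eq^j from their reciprocals, since the integral over [-π,π] then fails μ_0=1; and |q^{1+|n-2k|}/(abcd)|<1 is assumed for all k≤n so that the series converge. *)

theory Defs
  imports "HOL-Complex_Analysis.Complex_Analysis"
begin

definition qpoch :: "complex \<Rightarrow> complex \<Rightarrow> nat \<Rightarrow> complex" where
  "qpoch a q k = (\<Prod>j<k. 1 - a * q ^ j)"

definition qpoch_inf :: "complex \<Rightarrow> complex \<Rightarrow> complex" where
  "qpoch_inf a q = (\<Prod>j. 1 - a * q ^ j)"

definition qpochs :: "complex list \<Rightarrow> complex \<Rightarrow> nat \<Rightarrow> complex" where
  "qpochs as q k = (\<Prod>a\<leftarrow>as. qpoch a q k)"

definition qpochs_inf :: "complex list \<Rightarrow> complex \<Rightarrow> complex" where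
  "qpochs_inf as q = (\<Prod>a\<leftarrow>as. qpoch_inf a q)"

(* The series with r+1 upper and r lower parameters; it is only used with
   length as = Suc (length bs), where no further power of q enters the summand. *)
definition qhyp :: "complex list \<Rightarrow> complex list \<Rightarrow> complex \<Rightarrow> complex \<Rightarrow> complex" where
  "qhyp as bs q z = (\<Sum>k. qpochs as q k / qpochs (q # bs) q k * z ^ k)"

(* The choice of the square root is immaterial: both roots occur symmetrically. *)
definition W65 ::
  "complex \<Rightarrow> complex \<Rightarrow> complex \<Rightarrow> complex \<Rightarrow> complex \<Rightarrow> complex \<Rightarrow> complex" where
  "W65 \<alpha> \<beta> \<gamma> \<delta> q z =
     qhyp [\<alpha>, q * csqrt \<alpha>, - q * csqrt \<alpha>, \<beta>, \<gamma>, \<delta>]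
          [csqrt \<alpha>, - csqrt \<alpha>, q * \<alpha> / \<beta>, q * \<alpha> / \<gamma>, q * \<alpha> / \<delta>] q z"

definition absdiff :: "nat \<Rightarrow> nat \<Rightarrow> nat" where
  "absdiff n k = nat \<bar>int n - 2 * int k\<bar>"

definition aw_F ::
  "complex \<Rightarrow> nat \<Rightarrow> nat \<Rightarrow> complex \<Rightarrow> complex \<Rightarrow> complex \<Rightarrow> complex \<Rightarrow> complex" where
  "aw_F q n k a b c d =
     qpoch_inf (1 / a\<^sup>2) q * a ^ absdiff n k
       / qpochs_inf [a * b, a * c, a * d, b / a, c / a, d / a] q
     * W65 (a\<^sup>2) (a * b) (a * c) (a * d) q (q ^ (1 + absdiff n k) / (a * b * c * d))"

(* The weight as a function of z; the weight w(theta) is its value at z = exp(i theta). *)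
definition aw_weight ::
  "complex \<Rightarrow> complex \<Rightarrow> complex \<Rightarrow> complex \<Rightarrow> complex \<Rightarrow> complex \<Rightarrow> complex" where
  "aw_weight q a b c d z =
     qpochs_inf [z\<^sup>2, 1 / z\<^sup>2] q
     / qpochs_inf [a * z, a / z, b * z, b / z, c * z, c / z, d * z, d / z] q"

definition aw_const ::
  "complex \<Rightarrow> complex \<Rightarrow> complex \<Rightarrow> complex \<Rightarrow> complex \<Rightarrow> complex" where
  "aw_const q a b c d =
     qpochs_inf [q, a * b, a * c, a * d, b * c, b * d, c * d] q
     / (4 * of_real pi * qpoch_inf (a * b * c * d) q)"

(* The moments for parameters in the open unit disc. *)
definition aw_moment ::
  "complex \<Rightarrow> complex \<Rightarrow> complex \<Rightarrow> complex \<Rightarrow> complex \<Rightarrow> nat \<Rightarrow> complex" where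
  "aw_moment q a b c d n =
     aw_const q a b c d *
     integral {- pi..pi} (\<lambda>\<theta>. aw_weight q a b c d (cis \<theta>) * of_real (cos \<theta> ^ n))"

(* If a parameter has modulus at least 1, the integral over the unit circle is no longer
   normalized to give the value 1 for n = 0 (or does not exist). As usual for the
   Askey-Wilson integral, the circle is then deformed so that it separates the poles
   e * q^j of the weight, which accumulate at 0, from their reciprocals.
   The substitution z = exp(i theta) gives cos theta = (z + 1/z)/2 and
   d theta = dz/(i z). *)
definition aw_inner_poles ::
  "complex \<Rightarrow> complex \<Rightarrow> complex \<Rightarrow> complex \<Rightarrow> complex \<Rightarrow> complex set" where
  "aw_inner_poles q a b c d = {e * q ^ j | e j. e \<in> {a, b, c, d}}"

definition aw_contour ::
  "complex \<Rightarrow> complex \<Rightarrow> complex \<Rightarrow> complex \<Rightarrow> complex \<Rightarrow> (real \<Rightarrow> complex) \<Rightarrow> bool" where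
  "aw_contour q a b c d \<gamma> \<longleftrightarrow>
     valid_path \<gamma> \<and> pathfinish \<gamma> = pathstart \<gamma> \<and> 0 \<notin> path_image \<gamma> \<and>
     winding_number \<gamma> 0 = 1 \<and>
     (\<forall>p \<in> aw_inner_poles q a b c d.
        p \<notin> path_image \<gamma> \<and> 1 / p \<notin> path_image \<gamma> \<and>
        winding_number \<gamma> p = 1 \<and> winding_number \<gamma> (1 / p) = 0)"

definition aw_contour_moment ::
  "(real \<Rightarrow> complex) \<Rightarrow> complex \<Rightarrow> complex \<Rightarrow> complex \<Rightarrow> complex \<Rightarrow> complex \<Rightarrow> nat \<Rightarrow> complex" where
  "aw_contour_moment \<gamma> q a b c d n =
     aw_const q a b c d *
     contour_integral \<gamma> (\<lambda>z. aw_weight q a b c d z * ((z + 1 / z) / 2) ^ n / (\<i> * z))"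

end

theory Submission
  imports Defs
begin

text \<open>
  The \<open>n\<close>-th moment is a contour integral of \<open>w(z) ((z + 1/z)/2)^n\<close> with respect to
  \<open>dz/(i z)\<close>. Expanding the power leaves integrals of \<open>w(z) z^(m-1)\<close> with
  \<open>m = |n - 2k|\<close>. Formally, such an integral is \<open>2 \<pi> i\<close> times the sum of the residues at the
  poles \<open>e q^j\<close> inside the contour, where \<open>e\<close> is one of the four parameters, and the residues at
  \<open>a q^j\<close> are, for \<open>j = 0, 1, 2, ...\<close>, the terms of the very-well-poised series in
  \<open>F_k(a; b, c, d)\<close>. The difficulty is that these poles accumulate at \<open>0\<close>, which lies inside the
  contour, so the residue theorem for finitely many singularities does not apply to \<open>w\<close>.

  The remedy is a truncation of the factors that produce the accumulation: \<open>(1/z^2; q)\<^sub>\<infinity>\<close> is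
  replaced by \<open>(1/z^2; q)_{2N}\<close> and each of the four factors \<open>(e/z; q)\<^sub>\<infinity>\<close> in the denominator by
  \<open>(e/z; q)_N\<close>. Numerator and denominator then carry the same power \<open>z^(-4N)\<close>, so that the
  truncated weight is holomorphic at \<open>0\<close> and the only poles inside the contour are the points
  \<open>e q^j\<close> with \<open>j < N\<close>, together with a possible simple pole of \<open>z^(m-1)\<close> at \<open>0\<close>. The residue
  theorem gives \<open>contour_integral_truncated\<close>. As \<open>N\<close> tends to infinity,

  \<^item> the truncated weights converge to \<open>w\<close> uniformly on compact sets that avoid the poles,

  \<^item> the residue at \<open>0\<close> is \<open>0^m (q/(abcd))^N\<close>, which tends to \<open>0\<close> by the convergence condition,

  \<^item> the residue at \<open>a q^j\<close> is a product of a number depending only on \<open>j\<close>, with convergent sum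
    over \<open>j\<close>, and a number depending only on \<open>N - j\<close>, with a limit; so the sum of the residues
    converges by Tannery's theorem (\<open>tannery_convolution\<close>).

  This proves \<open>contour_integral_weight\<close>. The binomial expansion also produces negative exponents
  \<open>-m\<close>. Since \<open>w(1/z) = w(z)\<close>, and since inversion followed by a reversal of orientation
  turns an admissible contour into an admissible contour, the integrals for the exponents \<open>m\<close> and
  \<open>-m\<close> agree; this is why only \<open>|n - 2k|\<close> occurs in the formula.

  For parameters in the open unit disc the unit circle is an admissible contour, so this case is
  an instance of the general one.
\<close>

section \<open>The q-shifted factorials\<close>

lemma qpoch_0 [simp]: "qpoch a q 0 = 1"
  by (simp add: qpoch_def)

lemma qpoch_Suc: "qpoch a q (Suc n) = qpoch a q n * (1 - a * q ^ n)"
  by (simp add: qpoch_def)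

lemma qpoch_add: "qpoch a q (m + n) = qpoch a q m * qpoch (a * q ^ m) q n"
  by (induction n) (simp_all add: qpoch_Suc power_add mult_ac)

lemma qpoch_eq_0_iff: "qpoch a q n = 0 \<longleftrightarrow> (\<exists>j<n. a * q ^ j = 1)"
  by (auto simp: qpoch_def)

lemma convergent_prod_qpoch:
  assumes "norm q < 1"
  shows   "convergent_prod (\<lambda>j. 1 - a * q ^ j :: complex)"
proof -
  have "summable (\<lambda>j. norm (- (a * q ^ j)))"
    using assms by (auto simp: norm_mult norm_power intro!: summable_mult summable_geometric)
  then have "abs_convergent_prod (\<lambda>j. 1 + - (a * q ^ j))"
    by (rule summable_imp_abs_convergent_prod[OF summable_cong[THEN iffD1, rotated]]) auto
  then show ?thesis
    using abs_convergent_prod_imp_convergent_prod by force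
qed

lemma qpoch_inf_eq_0_iff:
  assumes "norm q < 1"
  shows   "qpoch_inf a q = 0 \<longleftrightarrow> (\<exists>j. a * q ^ j = 1)"
proof -
  have "(\<lambda>j. 1 - a * q ^ j) has_prod qpoch_inf a q"
    unfolding qpoch_inf_def using convergent_prod_qpoch[OF assms] by (rule convergent_prod_has_prod)
  then show ?thesis
    by (subst has_prod_eq_0_iff) (auto simp: image_iff eq_commute[of 1] eq_diff_eq)
qed

lemma qpoch_tendsto:
  assumes "norm q < 1"
  shows   "(\<lambda>n. qpoch a q n) \<longlonglongrightarrow> qpoch_inf a q"
proof -
  have "(\<lambda>n. \<Prod>j\<le>n. 1 - a * q ^ j) \<longlonglongrightarrow> qpoch_inf a q"
    unfolding qpoch_inf_def using convergent_prod_qpoch[OF assms] by (rule convergent_prod_LIMSEQ)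
  then show ?thesis
    by (subst filterlim_sequentially_Suc [symmetric]) (simp add: qpoch_def lessThan_Suc_atMost)
qed

lemma qpoch_inf_split:
  assumes "norm q < 1"
  shows   "qpoch_inf a q = qpoch a q n * qpoch_inf (a * q ^ n) q"
proof (rule LIMSEQ_unique)
  show "(\<lambda>k. qpoch a q (n + k)) \<longlonglongrightarrow> qpoch_inf a q"
    using LIMSEQ_ignore_initial_segment[OF qpoch_tendsto[OF assms, of a], of n]
    by (simp add: add.commute)
  show "(\<lambda>k. qpoch a q (n + k)) \<longlonglongrightarrow> qpoch a q n * qpoch_inf (a * q ^ n) q"
    unfolding qpoch_add by (intro tendsto_mult tendsto_const qpoch_tendsto assms)
qed

lemma qpoch_uniform_limit:
  assumes "norm q < 1" "compact K"
  shows   "uniform_limit K (\<lambda>n a. qpoch a q n) (\<lambda>a. qpoch_inf a q) sequentially"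
proof -
  obtain B where B: "\<And>a. a \<in> K \<Longrightarrow> norm a \<le> B"
    using compact_imp_bounded[OF assms(2)] by (auto simp: bounded_iff)
  have "uniformly_convergent_on K (\<lambda>N a. \<Sum>n<N. norm ((1 - a * q ^ n) - 1))"
  proof (rule Weierstrass_m_test')
    show "norm (norm ((1 - a * q ^ n) - 1)) \<le> B * norm q ^ n" if "a \<in> K" for a n
      using B[OF that] by (auto simp: norm_mult norm_power intro!: mult_right_mono)
    show "summable (\<lambda>n. B * norm q ^ n)"
      using assms by (auto intro!: summable_mult summable_geometric)
  qed
  then have "uniformly_convergent_on K (\<lambda>n a. qpoch a q n)"
    unfolding qpoch_def
    by (intro uniformly_convergent_on_prod' assms continuous_intros)
  then obtain l where l: "uniform_limit K (\<lambda>n a. qpoch a q n) l sequentially"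
    by (auto simp: uniformly_convergent_on_def)
  have "l a = qpoch_inf a q" if "a \<in> K" for a
    using LIMSEQ_unique[OF tendsto_uniform_limitI[OF l that] qpoch_tendsto[OF assms(1), of a]] .
  with l show ?thesis
    by (simp cong: uniform_limit_cong')
qed

lemma holomorphic_qpoch [holomorphic_intros]:
  assumes "f holomorphic_on S"
  shows   "(\<lambda>z. qpoch (f z) q n) holomorphic_on S"
  unfolding qpoch_def by (intro holomorphic_intros assms)

lemma holomorphic_qpoch_inf:
  assumes "norm q < 1" "f holomorphic_on S"
  shows   "(\<lambda>z. qpoch_inf (f z) q) holomorphic_on S"
proof -
  have "(\<lambda>a. qpoch_inf a q) holomorphic_on UNIV"
  proof (rule holomorphic_uniform_sequence)
    show "(\<lambda>a. qpoch a q n) holomorphic_on UNIV" for n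
      by (intro holomorphic_intros)
    show "\<exists>d>0. cball a d \<subseteq> UNIV \<and>
        uniform_limit (cball a d) (\<lambda>n a. qpoch a q n) (\<lambda>a. qpoch_inf a q) sequentially" for a
      using qpoch_uniform_limit[OF assms(1) compact_cball, of a 1] by (intro exI[of _ 1]) auto
  qed auto
  then show ?thesis
    using holomorphic_on_compose_gen[OF assms(2)] by (auto simp: o_def)
qed

text \<open>
  Reading the product backwards turns the factors \<open>1 - x q^(-i)\<close>, which arise when a
  residue is evaluated at \<open>a q^j\<close>, into the factors \<open>1 - q^i / x\<close> of a hypergeometric term.
\<close>
lemma qpoch_reverse:
  assumes "q \<noteq> 0" "x \<noteq> 0"
  shows   "qpoch (x / q ^ k) q k = (- x) ^ k / q ^ (\<Sum>{..k}) * qpoch (q / x) q k"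
proof (induction k)
  case (Suc k)
  have "qpoch (x / q ^ Suc k) q (1 + k) = qpoch (x / q ^ Suc k) q 1 * qpoch (x / q ^ Suc k * q ^ 1) q k"
    by (rule qpoch_add)
  also have "qpoch (x / q ^ Suc k) q 1 = - x / q ^ Suc k * (1 - q / x * q ^ k)"
    using assms by (simp add: qpoch_def field_simps)
  also have "x / q ^ Suc k * q ^ 1 = x / q ^ k"
    using assms by simp
  finally show ?case
    by (simp add: Suc.IH qpoch_Suc power_add mult_ac)
qed simp

lemma qpoch_uniform_limit_compose:
  assumes "norm q < 1" "compact K" "continuous_on K g"
  shows "uniform_limit K (\<lambda>n z. qpoch (g z) q n) (\<lambda>z. qpoch_inf (g z) q) sequentially"
  using qpoch_uniform_limit[OF assms(1) compact_continuous_image[OF assms(3,2)]]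
  by (rule uniform_limit_compose') auto

text \<open>
  The four parameters with square roots in a very-well-poised series contribute this rational
  factor. It depends only on \<open>\<alpha>\<close>, so the branch of the square root is irrelevant.
\<close>
lemma very_well_poised_ratio:
  assumes "s\<^sup>2 = \<alpha>" and nz: "\<And>i. \<alpha> * q ^ (2 * i) \<noteq> 1"
  shows "qpoch (q * s) q j * qpoch (- q * s) q j / (qpoch s q j * qpoch (- s) q j) =
         (1 - \<alpha> * q ^ (2 * j)) / (1 - \<alpha>)"
proof -
  have ne: "t * q ^ i \<noteq> 1" if "t\<^sup>2 = \<alpha>" for t i
  proof
    assume "t * q ^ i = 1"
    then have "(t * q ^ i)\<^sup>2 = 1" by simp
    with nz[of i] that show False by (simp add: power_mult_distrib power_even_eq)
  qed
  have ratio: "qpoch (q * t) q j = qpoch t q j * ((1 - t * q ^ j) / (1 - t))" if "t\<^sup>2 = \<alpha>" for t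
  proof -
    have "(1 - t) * qpoch (q * t) q j = qpoch t q (1 + j)"
      by (simp only: qpoch_add) (simp add: qpoch_def mult_ac)
    also have "\<dots> = qpoch t q j * (1 - t * q ^ j)"
      by (simp add: qpoch_Suc)
    finally show ?thesis
      using ne[OF that, of 0] by (simp add: nonzero_eq_divide_eq mult_ac)
  qed
  have s: "s\<^sup>2 = \<alpha>" "(- s)\<^sup>2 = \<alpha>" using assms(1) by auto
  have "qpoch s q j \<noteq> 0" "qpoch (- s) q j \<noteq> 0"
    using ne[OF s(1)] ne[OF s(2)] by (auto simp: qpoch_eq_0_iff)
  then have "qpoch (q * s) q j * qpoch (- q * s) q j / (qpoch s q j * qpoch (- s) q j) =
      ((1 - s * q ^ j) / (1 - s)) * ((1 + s * q ^ j) / (1 + s))"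
    using ratio[OF s(1)] ratio[OF s(2)] by simp
  also have "\<dots> = (1 - \<alpha> * q ^ (2 * j)) / (1 - \<alpha>)"
  proof -
    have "(1 - s * q ^ j) * (1 + s * q ^ j) = 1 - \<alpha> * q ^ (2 * j)"
      unfolding power_even_eq assms(1)[symmetric] by (simp add: algebra_simps power2_eq_square)
    moreover have "(1 - s) * (1 + s) = 1 - \<alpha>"
      unfolding assms(1)[symmetric] by (simp add: algebra_simps power2_eq_square)
    ultimately show ?thesis by (simp add: times_divide_times_eq)
  qed
  finally show ?thesis .
qed

section \<open>Limits of sums, products and contour integrals\<close>

lemma uniform_lim_prod:
  fixes f :: "'i \<Rightarrow> 'a \<Rightarrow> 'b \<Rightarrow> 'c :: {real_normed_field}"
  assumes "finite I"
    and "\<And>i. i \<in> I \<Longrightarrow> uniform_limit S (f i) (l i) F"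
    and "\<And>i. i \<in> I \<Longrightarrow> bounded (l i ` S)"
  shows "uniform_limit S (\<lambda>n x. \<Prod>i\<in>I. f i n x) (\<lambda>x. \<Prod>i\<in>I. l i x) F \<and>
         bounded ((\<lambda>x. \<Prod>i\<in>I. l i x) ` S)"
  using assms
proof (induction I rule: finite_induct)
  case empty
  then show ?case by (auto intro!: uniform_limit_const simp: bounded_iff)
next
  case (insert i I)
  have "bounded ((\<lambda>x. l i x * (\<Prod>i\<in>I. l i x)) ` S)"
  proof -
    have "bounded (l i ` S)" "bounded ((\<lambda>x. \<Prod>i\<in>I. l i x) ` S)"
      using insert by auto
    then obtain A B where "\<forall>x\<in>S. norm (l i x) \<le> A" "\<forall>x\<in>S. norm (\<Prod>i\<in>I. l i x) \<le> B"
      by (auto simp: bounded_iff)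
    then have "\<forall>x\<in>S. norm (l i x * (\<Prod>i\<in>I. l i x)) \<le> A * B"
      by (auto simp: norm_mult intro!: mult_mono order_trans[OF norm_ge_zero])
    then show ?thesis
      by (auto simp: bounded_iff)
  qed
  moreover have "uniform_limit S (\<lambda>n x. f i n x * (\<Prod>i\<in>I. f i n x))
      (\<lambda>x. l i x * (\<Prod>i\<in>I. l i x)) F"
    using insert by (intro uniform_lim_mult) auto
  ultimately show ?case
    using insert.hyps by simp
qed

text \<open>
  Extending the finite sums by zero makes this an instance of Tannery's theorem, with the terms
  \<open>K j\<close>, multiplied by a bound for the convergent sequence \<open>B\<close>, as dominating series.
\<close>
lemma tannery_convolution:
  fixes K B :: "nat \<Rightarrow> complex"
  assumes K: "summable (\<lambda>j. norm (K j))" and B: "B \<longlonglongrightarrow> L"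
  shows "(\<lambda>N. \<Sum>j<N. K j * B (N - j)) \<longlonglongrightarrow> suminf K * L"
proof -
  obtain C where C: "\<And>n. norm (B n) \<le> C"
    using convergent_imp_Bseq[OF convergentI[OF B]] by (auto simp: Bseq_def)
  define A where "A j N = (if j < N then K j * B (N - j) else 0)" for j N
  have "(\<lambda>N. suminf (\<lambda>j. A j N)) \<longlonglongrightarrow> (\<Sum>j. K j * L)"
  proof (rule tannerys_theorem[THEN conjunct2, THEN conjunct2])
    fix j
    have "(\<lambda>N. B (N - j)) \<longlonglongrightarrow> L"
      by (rule filterlim_compose[OF B filterlim_minus_const_nat_at_top])
    then have "(\<lambda>N. K j * B (N - j)) \<longlonglongrightarrow> K j * L"
      by (intro tendsto_intros)
    then show "(\<lambda>N. A j N) \<longlonglongrightarrow> K j * L"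
      by (rule Lim_transform_eventually)
         (use eventually_gt_at_top[of j] in eventually_elim, simp add: A_def)
  next
    have "norm (A j N) \<le> norm (K j) * C" for j N
      using C[of "N - j"] order_trans[OF norm_ge_zero C]
      by (auto simp: A_def norm_mult intro!: mult_left_mono mult_nonneg_nonneg)
    then show "\<forall>\<^sub>F (j, N) in at_top \<times>\<^sub>F sequentially. norm (A j N) \<le> norm (K j) * C"
      by (intro always_eventually) auto
    show "summable (\<lambda>j. norm (K j) * C)"
      using K by (rule summable_mult2)
  qed auto
  moreover have "suminf (\<lambda>j. A j N) = (\<Sum>j<N. K j * B (N - j))" for N
    by (subst suminf_finite[of "{..<N}"]) (auto simp: A_def)
  moreover have "(\<Sum>j. K j * L) = suminf K * L"
    using summable_norm_cancel[OF K] by (rule suminf_mult2[symmetric])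
  ultimately show ?thesis by simp
qed

lemma summable_norm_convergent_mult_power:
  fixes c :: "nat \<Rightarrow> complex"
  assumes "convergent c" "norm z < 1"
  shows "summable (\<lambda>j. norm (c j * z ^ j))"
proof -
  obtain C where "\<And>n. norm (c n) \<le> C"
    using convergent_imp_Bseq[OF assms(1)] by (auto simp: Bseq_def)
  then have bound: "norm (norm (c j * z ^ j)) \<le> C * norm z ^ j" for j
    by (auto simp: norm_mult norm_power intro!: mult_right_mono)
  have "summable (\<lambda>j. C * norm z ^ j)"
    using assms by (intro summable_mult summable_geometric) auto
  then show ?thesis
    by (rule summable_comparison_test'[of _ 0]) (rule bound)
qed

text \<open>
  The derivative of a piecewise continuously differentiable path may be unbounded near the
  exceptional points, which rules out a naive passage to the limit under the integral sign. A
  close polynomial path has the same integrals and a bounded derivative.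
\<close>
lemma polynomial_replacement_of_loop:
  assumes "open S" "valid_path \<gamma>" "pathfinish \<gamma> = pathstart \<gamma>" "path_image \<gamma> \<subseteq> S"
  obtains p where "polynomial_function p" "valid_path p" "path_image p \<subseteq> S"
    "\<And>f. f holomorphic_on S \<Longrightarrow> contour_integral p f = contour_integral \<gamma> f"
proof -
  obtain d where d: "d > 0"
    and near: "\<And>g h. \<lbrakk>valid_path g; valid_path h; \<forall>t\<in>{0..1}. norm (g t - \<gamma> t) < d \<and> norm (h t - \<gamma> t) < d;
        pathfinish g = pathstart g; pathfinish h = pathstart h\<rbrakk>
      \<Longrightarrow> path_image g \<subseteq> S \<and> path_image h \<subseteq> S \<and>
          (\<forall>f. f holomorphic_on S \<longrightarrow> contour_integral h f = contour_integral g f)"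
    using contour_integral_nearby_loops[OF assms(1) valid_path_imp_path[OF assms(2)] assms(4)] assms(3)
    by metis
  obtain p where p: "polynomial_function p" "pathstart p = pathstart \<gamma>" "pathfinish p = pathfinish \<gamma>"
    "\<And>t. t \<in> {0..1} \<Longrightarrow> norm (p t - \<gamma> t) < d"
    using path_approx_polynomial_function[OF valid_path_imp_path[OF assms(2)] d] by blast
  have v: "valid_path p"
    using p(1) by (rule valid_path_polynomial_function)
  show ?thesis
    using near[of \<gamma> p] p v assms d by (intro that[of p]) auto
qed

section \<open>The weight, its truncation and the poles\<close>

text \<open>
  The parameters form a set, because they play symmetric roles: products over \<open>E\<close> and over
  \<open>E - {a}\<close> then treat the residues at all four families of poles at once.
\<close>
definition weight :: "complex \<Rightarrow> complex set \<Rightarrow> complex \<Rightarrow> complex" where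
  "weight q E z = qpoch_inf (z\<^sup>2) q * qpoch_inf (1 / z\<^sup>2) q /
     (\<Prod>e\<in>E. qpoch_inf (e * z) q * qpoch_inf (e / z) q)"

text \<open>
  The length \<open>2 * N\<close> in the numerator balances four factors of length \<open>N\<close> in the
  denominator: in both, the leading power of \<open>1 / z\<close> is \<open>4 * N\<close>.
\<close>
definition truncated_weight :: "complex \<Rightarrow> complex set \<Rightarrow> nat \<Rightarrow> complex \<Rightarrow> complex" where
  "truncated_weight q E N z = qpoch_inf (z\<^sup>2) q * qpoch (1 / z\<^sup>2) q (2 * N) /
     (\<Prod>e\<in>E. qpoch_inf (e * z) q * qpoch (e / z) q N)"

text \<open>
  The condition \<open>separated\<close> makes the poles \<open>e * q ^ j\<close> simple and distinct, and \<open>products\<close>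
  keeps them away from their reciprocals. The latter includes \<open>e = f\<close>, hence \<open>a\<^sup>2 \<noteq> 1\<close>; the
  difference \<open>1 - a\<^sup>2\<close> is a denominator of the very-well-poised series.
\<close>
locale aw_params =
  fixes q :: complex and E :: "complex set"
  assumes q_nonzero: "q \<noteq> 0" and q_norm: "norm q < 1"
    and card_E: "card E = 4" and E_nonzero: "0 \<notin> E"
    and separated: "\<And>e f i j. \<lbrakk>e \<in> E; f \<in> E; e \<noteq> f\<rbrakk> \<Longrightarrow> e * q ^ i \<noteq> f * q ^ j"
    and products: "\<And>e f j. \<lbrakk>e \<in> E; f \<in> E\<rbrakk> \<Longrightarrow> e * f * q ^ j \<noteq> 1"
begin

lemma finite_E: "finite E"
  using card_E by (metis card.infinite zero_neq_numeral)

lemma q_power_inj: "q ^ i = q ^ j \<longleftrightarrow> i = j"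
proof -
  have *: "q ^ k \<noteq> 1" if "k > 0" for k
  proof
    assume "q ^ k = 1"
    then have "norm q ^ k = 1" by (metis norm_one norm_power)
    with q_norm that show False
      by (metis norm_ge_zero less_irrefl power_less_one_iff)
  qed
  have "i = j" if "q ^ i = q ^ j" "i \<le> j" for i j
  proof (rule ccontr)
    assume "i \<noteq> j"
    have "q ^ j = q ^ i * q ^ (j - i)"
      using that by (metis le_add_diff_inverse power_add)
    then have "q ^ (j - i) = 1" using that q_nonzero by simp
    with *[of "j - i"] \<open>i \<noteq> j\<close> that show False by simp
  qed
  then show ?thesis by (metis nle_le)
qed

lemma q_power_Suc_neq_1: "q * q ^ j \<noteq> 1"
  using q_power_inj[of "Suc j" 0] by simp

lemmas qpoch_inf_zero_iff = qpoch_inf_eq_0_iff[OF q_norm]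
lemmas holomorphic_qpoch_inf_q [holomorphic_intros] = holomorphic_qpoch_inf[OF q_norm]

definition outer_poles :: "complex set" where
  "outer_poles = {1 / (e * q ^ j) | e j. e \<in> E}"

lemma outer_poles_iff: "z \<in> outer_poles \<longleftrightarrow> (\<Prod>e\<in>E. qpoch_inf (e * z) q) = 0"
proof
  assume "z \<in> outer_poles"
  then obtain e j where e: "e \<in> E" "z = 1 / (e * q ^ j)" by (auto simp: outer_poles_def)
  then have "e * z * q ^ j = 1" using E_nonzero q_nonzero by auto
  then show "(\<Prod>e\<in>E. qpoch_inf (e * z) q) = 0"
    using e(1) finite_E by (auto simp: qpoch_inf_zero_iff)
next
  assume "(\<Prod>e\<in>E. qpoch_inf (e * z) q) = 0"
  then obtain e j where e: "e \<in> E" "e * z * q ^ j = 1"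
    using finite_E by (auto simp: qpoch_inf_zero_iff)
  moreover from this have "e * q ^ j \<noteq> 0" using E_nonzero q_nonzero by auto
  ultimately have "z = 1 / (e * q ^ j)" by (simp add: eq_divide_eq mult_ac)
  with e show "z \<in> outer_poles" by (auto simp: outer_poles_def)
qed

lemma open_Compl_outer_poles: "open (- outer_poles)"
proof -
  have "continuous_on UNIV (\<lambda>z. \<Prod>e\<in>E. qpoch_inf (e * z) q)"
    by (intro holomorphic_on_imp_continuous_on holomorphic_intros)
  then have "closed {z. (\<Prod>e\<in>E. qpoch_inf (e * z) q) = 0}"
    using continuous_closed_preimage_constant[of UNIV "\<lambda>z. \<Prod>e\<in>E. qpoch_inf (e * z) q" 0] by simp
  moreover have "outer_poles = {z. (\<Prod>e\<in>E. qpoch_inf (e * z) q) = 0}"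
    using outer_poles_iff by blast
  ultimately show ?thesis
    by (simp add: open_Compl)
qed

text \<open>
  The residue theorem will be applied on this domain, which is connected because only countably
  many points are removed.
\<close>
lemma connected_Compl_outer_poles: "connected (- outer_poles)"
proof (intro path_connected_imp_connected path_connected_complement_countable)
  have "outer_poles = (\<Union>e\<in>E. range (\<lambda>j. 1 / (e * q ^ j)))"
    by (auto simp: outer_poles_def)
  then show "countable outer_poles"
    using finite_E by (simp add: countable_finite)
qed auto

lemma inner_not_outer: "a \<in> E \<Longrightarrow> a * q ^ j \<notin> outer_poles"
proof
  assume a: "a \<in> E" and "a * q ^ j \<in> outer_poles"
  then obtain e i where "e \<in> E" "a * q ^ j = 1 / (e * q ^ i)" by (auto simp: outer_poles_def)
  moreover have "a * e * q ^ (j + i) = (a * q ^ j) * (e * q ^ i)"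
    by (simp add: power_add)
  ultimately have "a * e * q ^ (j + i) = 1"
    using E_nonzero q_nonzero by auto
  with products a \<open>e \<in> E\<close> show False by blast
qed

lemma zero_not_outer: "0 \<notin> outer_poles"
  using E_nonzero q_nonzero by (auto simp: outer_poles_def)

section \<open>Residues of the truncated weight\<close>

text \<open>
  The residue of \<open>truncated_weight q E N z * z ^ m / z\<close> at \<open>a * q ^ j\<close> splits into a head that
  does not depend on \<open>N\<close> and a tail that depends only on \<open>N - j\<close>. The tail has one factorial of
  length \<open>n - 1\<close> because the vanishing factor is missing from it; \<open>n = N - j\<close> is positive for
  \<open>j < N\<close>.
\<close>
definition residue_head :: "nat \<Rightarrow> complex \<Rightarrow> nat \<Rightarrow> complex" where
  "residue_head m a j = (a * q ^ j) ^ m * qpoch_inf ((a * q ^ j)\<^sup>2) q *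
     qpoch (1 / a\<^sup>2 / q ^ (2 * j)) q (2 * j) /
     ((\<Prod>e\<in>E. qpoch_inf (e * (a * q ^ j)) q) * qpoch (1 / q ^ j) q j *
      (\<Prod>e\<in>E - {a}. qpoch (e / a / q ^ j) q j))"

definition residue_tail :: "complex \<Rightarrow> nat \<Rightarrow> complex" where
  "residue_tail a n = qpoch (1 / a\<^sup>2) q (2 * n) /
     (qpoch q q (n - 1) * (\<Prod>e\<in>E - {a}. qpoch (e / a) q n))"

definition residue_tail_limit :: "complex \<Rightarrow> complex" where
  "residue_tail_limit a = qpoch_inf (1 / a\<^sup>2) q /
     (qpoch_inf q q * (\<Prod>e\<in>E - {a}. qpoch_inf (e / a) q))"

lemma residue_tail_tendsto:
  assumes a: "a \<in> E"
  shows "residue_tail a \<longlonglongrightarrow> residue_tail_limit a"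
proof -
  have "(\<lambda>n. qpoch (1 / a\<^sup>2) q (2 * n)) \<longlonglongrightarrow> qpoch_inf (1 / a\<^sup>2) q"
    by (rule filterlim_compose[OF qpoch_tendsto[OF q_norm]]) (rule mult_nat_left_at_top, simp)
  moreover have "(\<lambda>n. qpoch q q (n - 1)) \<longlonglongrightarrow> qpoch_inf q q"
    by (rule filterlim_compose[OF qpoch_tendsto[OF q_norm] filterlim_minus_const_nat_at_top])
  moreover have "qpoch_inf q q \<noteq> 0"
    using q_power_Suc_neq_1 by (simp add: qpoch_inf_zero_iff)
  moreover have "qpoch_inf (e / a) q \<noteq> 0" if "e \<in> E - {a}" for e
  proof
    assume "qpoch_inf (e / a) q = 0"
    then obtain j where "e / a * q ^ j = 1" by (auto simp: qpoch_inf_zero_iff)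
    then have "e * q ^ j = a * q ^ 0" using a E_nonzero by (auto simp: field_simps)
    with separated[of e a j 0] that a show False by auto
  qed
  ultimately show ?thesis
    unfolding residue_tail_def [abs_def] residue_tail_limit_def
    using finite_E by (intro tendsto_intros qpoch_tendsto q_norm) auto
qed

text \<open>
  Only the factor \<open>1 - a * q ^ j / z\<close> of the denominator vanishes at \<open>p = a * q ^ j\<close>. In each
  of the other finite products the first \<open>j\<close> factors (\<open>2 * j\<close> in the numerator) contain
  negative powers of \<open>q\<close> and go into the head; the remaining factors form a product that starts
  afresh and whose length depends only on \<open>N - j\<close>.
\<close>
lemma truncated_weight_residue:
  assumes a: "a \<in> E" and j: "j < N"
  shows "residue (\<lambda>z. truncated_weight q E N z * z ^ m / z) (a * q ^ j) =
         residue_head m a j * residue_tail a (N - j)"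
proof -
  define p where "p = a * q ^ j"
  have a0: "a \<noteq> 0" and p0: "p \<noteq> 0" using a E_nonzero q_nonzero by (auto simp: p_def)
  \<comment> \<open>The truncated weight times \<open>z ^ (m - 1) * (z - p)\<close>, with the vanishing factor cancelled.\<close>
  define H where "H z = qpoch_inf (z\<^sup>2) q * qpoch (1 / z\<^sup>2) q (2 * N) * z ^ m /
      ((\<Prod>e\<in>E. qpoch_inf (e * z) q) * (\<Prod>e\<in>E-{a}. qpoch (e / z) q N) *
       (\<Prod>i\<in>{..<N}-{j}. 1 - a / z * q ^ i))" for z
  \<comment> \<open>The complement of all singularities other than \<open>p\<close>.\<close>
  define U where "U = - (outer_poles \<union> (insert 0 ((\<lambda>(e,i). e * q ^ i) ` (E \<times> {..<N}) - {p})))"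
  have "open U"
    unfolding U_def Compl_Un using finite_E
    by (intro open_Int open_Compl_outer_poles open_Compl finite_imp_closed) auto
  have "p \<in> U"
    using inner_not_outer[OF a] p0 by (auto simp: U_def p_def)
  have other: "e / z * q ^ i \<noteq> 1"
    if "z \<in> U" "e \<in> E" "i < N" "e \<noteq> a \<or> i \<noteq> j" for z e i
  proof
    assume "e / z * q ^ i = 1"
    then have z: "z = e * q ^ i" by (auto simp: field_simps split: if_splits)
    have "z \<noteq> p"
    proof (cases "e = a")
      case True
      with that z show ?thesis using q_power_inj[of i j] a0 by (auto simp: p_def)
    next
      case False
      with separated[of e a i j] that a z show ?thesis by (auto simp: p_def)
    qed
    with z that show False by (force simp: U_def)
  qed
  have "H holomorphic_on U"
    unfolding H_def
  proof (intro holomorphic_intros)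
    fix z assume z: "z \<in> U"
    then have "(\<Prod>e\<in>E. qpoch_inf (e * z) q) \<noteq> 0"
      unfolding U_def outer_poles_iff[symmetric] by blast
    moreover have "(\<Prod>e\<in>E-{a}. qpoch (e / z) q N) \<noteq> 0"
      using other[OF z] finite_E by (auto simp: qpoch_eq_0_iff)
    moreover have "(\<Prod>i\<in>{..<N}-{j}. 1 - a / z * q ^ i) \<noteq> 0"
      using other[OF z a] by auto
    ultimately show "(\<Prod>e\<in>E. qpoch_inf (e * z) q) * (\<Prod>e\<in>E-{a}. qpoch (e / z) q N) *
       (\<Prod>i\<in>{..<N}-{j}. 1 - a / z * q ^ i) \<noteq> 0"
      by simp
  qed (auto simp: U_def)
  have "residue (\<lambda>z. truncated_weight q E N z * z ^ m / z) p = residue (\<lambda>z. H z / (z - p)) p"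
  proof (rule residue_cong)
    have "eventually (\<lambda>z. z \<in> U \<and> z \<noteq> p) (at p)"
      using \<open>open U\<close> \<open>p \<in> U\<close> by (simp add: eventually_at_topological) blast
    then show "eventually (\<lambda>z. truncated_weight q E N z * z ^ m / z = H z / (z - p)) (at p)"
    proof eventually_elim
      case (elim z)
      then have z: "z \<noteq> 0" by (auto simp: U_def)
      have "(\<Prod>e\<in>E. qpoch (e / z) q N) = qpoch (a / z) q N * (\<Prod>e\<in>E-{a}. qpoch (e / z) q N)"
        using finite_E a by (rule prod.remove)
      also have "qpoch (a / z) q N = (1 - a / z * q ^ j) * (\<Prod>i\<in>{..<N}-{j}. 1 - a / z * q ^ i)"
        unfolding qpoch_def using j by (intro prod.remove) auto
      also have "1 - a / z * q ^ j = (z - p) / z"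
        using z by (simp add: p_def field_simps)
      finally show ?case
        using z elim by (simp add: truncated_weight_def H_def prod.distrib mult_ac)
    qed
  qed simp
  also have "\<dots> = H p"
    using \<open>open U\<close> \<open>p \<in> U\<close> \<open>H holomorphic_on U\<close> by (rule residue_simple)
  also have "H p = residue_head m a j * residue_tail a (N - j)"
  proof -
    have "1 / p\<^sup>2 = 1 / a\<^sup>2 / q ^ (2 * j)"
      by (simp add: p_def power_mult_distrib power_even_eq)
    moreover have "2 * N = 2 * j + 2 * (N - j)"
      using j by simp
    ultimately have "qpoch (1 / p\<^sup>2) q (2 * N) =
        qpoch (1 / a\<^sup>2 / q ^ (2 * j)) q (2 * j + 2 * (N - j))"
      by (rule arg_cong2)
    also have "\<dots> = qpoch (1 / a\<^sup>2 / q ^ (2 * j)) q (2 * j) * qpoch (1 / a\<^sup>2) q (2 * (N - j))"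
      using q_nonzero by (simp add: qpoch_add)
    finally have 1: "qpoch (1 / p\<^sup>2) q (2 * N) =
      qpoch (1 / a\<^sup>2 / q ^ (2 * j)) q (2 * j) * qpoch (1 / a\<^sup>2) q (2 * (N - j))" .
    have 2: "qpoch (e / p) q N = qpoch (e / a / q ^ j) q j * qpoch (e / a) q (N - j)" for e
      using qpoch_add[of "e / a / q ^ j" q j "N - j"] j q_nonzero by (simp add: p_def)
    have disj: "{..<j} \<inter> {Suc j..<N} = {}"
      by auto
    have "{..<N} - {j} = {..<j} \<union> {Suc j..<N}"
      using j by auto
    then have "(\<Prod>i\<in>{..<N}-{j}. 1 - a / p * q ^ i) =
       (\<Prod>i<j. 1 - a / p * q ^ i) * (\<Prod>i\<in>{Suc j..<N}. 1 - a / p * q ^ i)"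
      by (metis (no_types) finite_lessThan finite_atLeastLessThan disj prod.union_disjoint)
    also have "(\<Prod>i<j. 1 - a / p * q ^ i) = qpoch (1 / q ^ j) q j"
      using a0 by (simp add: qpoch_def p_def)
    also have "(\<Prod>i\<in>{Suc j..<N}. 1 - a / p * q ^ i) = (\<Prod>i<N - Suc j. 1 - a / p * q ^ (Suc j + i))"
      using j by (intro prod.reindex_bij_witness[of _ "\<lambda>i. Suc j + i" "\<lambda>i. i - Suc j"]) auto
    also have "\<dots> = qpoch q q (N - j - 1)"
      using a0 q_nonzero by (simp add: qpoch_def p_def power_add)
    finally have 3: "(\<Prod>i\<in>{..<N}-{j}. 1 - a / p * q ^ i) = qpoch (1 / q ^ j) q j * qpoch q q (N - j - 1)" .
    show ?thesis
      unfolding H_def 1 2 3 prod.distrib residue_head_def residue_tail_def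
      by (simp add: p_def mult_ac)
  qed
  finally show ?thesis by (simp add: p_def)
qed

text \<open>
  This is the value at \<open>0\<close> of the truncated weight, after clearing the powers of \<open>z\<close>. In the
  step from \<open>N\<close> to \<open>N + 1\<close> the numerator gains \<open>q ^ (2 * N) * q ^ (2 * N + 1)\<close> and the
  denominator \<open>\<Prod>E * q ^ (4 * N)\<close>.
\<close>
lemma prod_neg_q_powers:
  "(\<Prod>i<2 * N. - (q ^ i)) / (\<Prod>e\<in>E. \<Prod>i<N. - (e * q ^ i)) = (q / \<Prod>E) ^ N"
proof (induction N)
  case (Suc N)
  have E: "(\<Prod>e\<in>E. - (e * q ^ N)) = \<Prod>E * q ^ (4 * N)"
    using card_E by (simp add: prod.distrib prod_uminus power_mult mult.commute flip: power_mult)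
  have "(\<Prod>i<2 * Suc N. - (q ^ i)) = (\<Prod>i<2 * N. - (q ^ i)) * (q * q ^ (4 * N))"
    by (simp add: power_add flip: power_mult) (simp add: mult_2 mult_ac numeral_eq_Suc power_add)
  moreover have "(\<Prod>e\<in>E. \<Prod>i<Suc N. - (e * q ^ i)) =
      (\<Prod>e\<in>E. \<Prod>i<N. - (e * q ^ i)) * (\<Prod>E * q ^ (4 * N))"
    by (simp only: prod.lessThan_Suc prod.distrib E)
  ultimately have "(\<Prod>i<2 * Suc N. - (q ^ i)) / (\<Prod>e\<in>E. \<Prod>i<Suc N. - (e * q ^ i)) =
     ((\<Prod>i<2 * N. - (q ^ i)) / (\<Prod>e\<in>E. \<Prod>i<N. - (e * q ^ i))) * (q / \<Prod>E)"
    using q_nonzero by (simp del: mult_Suc_right prod.lessThan_Suc)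
  then show ?case using Suc.IH by simp
qed simp

text \<open>
  Multiplying numerator and denominator by \<open>z ^ (4 * N)\<close> exhibits the truncated weight as a
  function that is holomorphic at \<open>0\<close>. For \<open>m > 0\<close> nothing is left of the pole.
\<close>
lemma truncated_weight_residue_0:
  "residue (\<lambda>z. truncated_weight q E N z * z ^ m / z) 0 = 0 ^ m * (q / \<Prod>E) ^ N"
proof -
  define G where "G z = z ^ m * (qpoch_inf (z\<^sup>2) q * (\<Prod>i<2*N. z\<^sup>2 - q ^ i) /
     ((\<Prod>e\<in>E. qpoch_inf (e * z) q) * (\<Prod>e\<in>E. \<Prod>i<N. z - e * q ^ i)))" for z
  define U where "U = - (outer_poles \<union> (\<lambda>(e,i). e * q ^ i) ` (E \<times> {..<N}))"
  have "open U"
    unfolding U_def Compl_Un using finite_E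
    by (intro open_Int open_Compl_outer_poles open_Compl finite_imp_closed) auto
  have "0 \<in> U"
    using zero_not_outer E_nonzero q_nonzero by (auto simp: U_def)
  have "G holomorphic_on U"
    unfolding G_def
    by (intro holomorphic_intros) (force simp: U_def outer_poles_iff finite_E)+
  have "residue (\<lambda>z. truncated_weight q E N z * z ^ m / z) 0 = residue (\<lambda>z. G z / (z - 0)) 0"
  proof (rule residue_cong)
    have "eventually (\<lambda>z. z \<noteq> 0) (at (0::complex))"
      by (simp add: eventually_at_filter)
    then show "eventually (\<lambda>z. truncated_weight q E N z * z ^ m / z = G z / (z - 0)) (at 0)"
    proof eventually_elim
      case (elim z)
      have num: "qpoch (1 / z\<^sup>2) q (2 * N) = (\<Prod>i<2*N. z\<^sup>2 - q ^ i) / z ^ (4 * N)"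
      proof -
        have "qpoch (1 / z\<^sup>2) q (2 * N) = (\<Prod>i<2*N. (z\<^sup>2 - q ^ i) / z\<^sup>2)"
          unfolding qpoch_def using elim by (intro prod.cong) (auto simp: field_simps)
        then show ?thesis by (simp add: prod_dividef flip: power_mult)
      qed
      have "qpoch (e / z) q N = (\<Prod>i<N. z - e * q ^ i) / z ^ N" for e
      proof -
        have "qpoch (e / z) q N = (\<Prod>i<N. (z - e * q ^ i) / z)"
          unfolding qpoch_def using elim by (intro prod.cong) (auto simp: field_simps)
        then show ?thesis by (simp add: prod_dividef)
      qed
      then have den: "(\<Prod>e\<in>E. qpoch (e / z) q N) = (\<Prod>e\<in>E. \<Prod>i<N. z - e * q ^ i) / z ^ (4 * N)"
        using card_E by (simp add: prod_dividef mult.commute flip: power_mult)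
      show ?case
        using elim by (simp add: truncated_weight_def G_def prod.distrib num den)
    qed
  qed simp
  also have "\<dots> = G 0"
    using \<open>open U\<close> \<open>0 \<in> U\<close> \<open>G holomorphic_on U\<close> by (rule residue_simple)
  also have "\<dots> = 0 ^ m * (q / \<Prod>E) ^ N"
  proof -
    have "qpoch_inf 0 q = 1"
      by (simp add: qpoch_inf_def)
    then show ?thesis
      using prod_neg_q_powers[of N] by (simp add: G_def)
  qed
  finally show ?thesis .
qed

end

section \<open>The residues as terms of a very-well-poised series\<close>

text \<open>
  The exponents of \<open>q\<close> produced by \<open>qpoch_reverse\<close> are triangular numbers: one for length
  \<open>2 * j\<close> in the numerator and four for length \<open>j\<close> in the denominator. Their mismatch \<open>j\<close>
  accounts for the factor \<open>q ^ j\<close> of \<open>(q / \<Prod>E) ^ j\<close> in \<open>residue_head_eq\<close>.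
\<close>
lemma sum_atMost_double: "\<Sum>{..2 * j} + j = 4 * \<Sum>{..j::nat}"
  by (induction j) auto

context aw_params
begin

text \<open>The coefficients of the very-well-poised series, with the square roots eliminated.\<close>
definition series_coeff :: "complex \<Rightarrow> nat \<Rightarrow> complex" where
  "series_coeff a j = qpoch (a\<^sup>2) q j * ((1 - a\<^sup>2 * q ^ (2 * j)) / (1 - a\<^sup>2)) *
     (\<Prod>e\<in>E-{a}. qpoch (a * e) q j) / (qpoch q q j * (\<Prod>e\<in>E-{a}. qpoch (q * a / e) q j))"

lemma products_0: "e \<in> E \<Longrightarrow> f \<in> E \<Longrightarrow> e * f \<noteq> 1"
  using products[of e f 0] by simp

lemma qpoch_products: "e \<in> E \<Longrightarrow> f \<in> E \<Longrightarrow> qpoch (e * f) q n \<noteq> 0"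
  using products by (auto simp: qpoch_eq_0_iff)

lemma qpoch_inf_products: "e \<in> E \<Longrightarrow> f \<in> E \<Longrightarrow> qpoch_inf (e * f * q ^ n) q \<noteq> 0"
  using products[of e f] by (auto simp: qpoch_inf_zero_iff mult.assoc simp flip: power_add)

lemma qpoch_inf_ratio:
  assumes "a \<in> E" "e \<in> E" "e \<noteq> a"
  shows "qpoch_inf (q * a / e) q \<noteq> 0"
proof
  assume "qpoch_inf (q * a / e) q = 0"
  then obtain j where "q * a / e * q ^ j = 1" by (auto simp: qpoch_inf_zero_iff)
  then have "a * q ^ Suc j = e * q ^ 0" using assms E_nonzero by (auto simp: field_simps)
  with separated[of a e "Suc j" 0] assms show False by auto
qed

text \<open>
  All q-shifted factorials in the coefficient have limits, and those in the denominator have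
  nonzero limits, by \<open>separated\<close> and \<open>norm q < 1\<close>. So the series converges as soon as its argument has norm less
  than 1.
\<close>
lemma convergent_series_coeff:
  assumes "a \<in> E"
  shows "convergent (series_coeff a)"
proof -
  have "(\<lambda>j. q ^ (2 * j)) \<longlonglongrightarrow> 0"
    using filterlim_compose[OF LIMSEQ_power_zero[OF q_norm] mult_nat_left_at_top[of 2]] by simp
  moreover have "qpoch_inf q q \<noteq> 0"
    using q_power_Suc_neq_1 by (simp add: qpoch_inf_zero_iff)
  ultimately have "series_coeff a \<longlonglongrightarrow> qpoch_inf (a\<^sup>2) q * ((1 - a\<^sup>2 * 0) / (1 - a\<^sup>2)) *
     (\<Prod>e\<in>E-{a}. qpoch_inf (a * e) q) /
     (qpoch_inf q q * (\<Prod>e\<in>E-{a}. qpoch_inf (q * a / e) q))"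
    unfolding series_coeff_def [abs_def]
    using finite_E qpoch_inf_ratio[OF assms] products_0[OF assms assms]
    by (intro tendsto_intros qpoch_tendsto q_norm) (auto simp: power2_eq_square)
  then show ?thesis by (rule convergentI)
qed

text \<open>
  All factors with negative powers of \<open>q\<close> are reversed by \<open>qpoch_reverse\<close>. The resulting
  monomials combine to \<open>(q / \<Prod>E) ^ j\<close>, and \<open>(a * q ^ j) ^ m\<close> supplies the rest of the argument of
  the series.
\<close>
lemma residue_head_eq:
  assumes a: "a \<in> E"
  shows "residue_head m a j = a ^ m / (\<Prod>e\<in>E-{a}. qpoch_inf (a * e) q) *
           (series_coeff a j * (q ^ (m + 1) / \<Prod>E) ^ j)"
proof -
  \<comment> \<open>Names are given to the products over the three parameters other than \<open>a\<close>, so that the final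
    computation involves single letters only.\<close>
  define R where "R = \<Prod>(E - {a})"
  define X where "X = (\<Prod>e\<in>E-{a}. qpoch_inf (e * (a * q ^ j)) q)"
  define Y where "Y = (\<Prod>e\<in>E-{a}. qpoch (a * e) q j)"
  define Z where "Z = (\<Prod>e\<in>E-{a}. qpoch (q * a / e) q j)"
  have a0: "a \<noteq> 0" and R0: "R \<noteq> 0"
    using a E_nonzero finite_E by (auto simp: R_def)
  have prodE: "\<Prod>E = a * R"
    unfolding R_def using finite_E a by (rule prod.remove)
  have card3: "card (E - {a}) = 3"
    using card_E a finite_E by simp
  have X0: "X \<noteq> 0" and Y0: "Y \<noteq> 0"
    using qpoch_inf_products[OF _ a] qpoch_products[OF a] finite_E
    by (auto simp: X_def Y_def mult.assoc)
  have XY: "(\<Prod>e\<in>E-{a}. qpoch_inf (a * e) q) = Y * X"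
    unfolding X_def Y_def prod.distrib [symmetric]
    by (intro prod.cong refl, subst qpoch_inf_split[OF q_norm, of _ j]) (simp add: mult_ac)
  have allX: "(\<Prod>e\<in>E. qpoch_inf (e * (a * q ^ j)) q) = qpoch_inf (a\<^sup>2 * q ^ j) q * X"
    unfolding X_def by (subst prod.remove[OF finite_E a]) (simp add: power2_eq_square mult_ac)
  \<comment> \<open>The factors in \<open>a\<^sup>2\<close> alone give the very-well-poised part of the coefficient.\<close>
  have wp: "qpoch_inf ((a * q ^ j)\<^sup>2) q * qpoch (q * a\<^sup>2) q (2 * j) =
      qpoch (a\<^sup>2) q j * ((1 - a\<^sup>2 * q ^ (2 * j)) / (1 - a\<^sup>2)) * qpoch_inf (a\<^sup>2 * q ^ j) q"
  proof -
    have "(1 - a\<^sup>2) * qpoch (q * a\<^sup>2) q (2 * j) = qpoch (a\<^sup>2) q (1 + 2 * j)"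
      by (simp only: qpoch_add) (simp add: qpoch_def mult_ac)
    also have "\<dots> = qpoch (a\<^sup>2) q (2 * j) * (1 - a\<^sup>2 * q ^ (2 * j))"
      by (simp add: qpoch_Suc)
    finally have 1: "qpoch (q * a\<^sup>2) q (2 * j) =
        qpoch (a\<^sup>2) q (2 * j) * ((1 - a\<^sup>2 * q ^ (2 * j)) / (1 - a\<^sup>2))"
      using products_0[OF a a] by (simp add: nonzero_eq_divide_eq power2_eq_square mult_ac)
    have "(a * q ^ j)\<^sup>2 = a\<^sup>2 * q ^ (2 * j)"
      by (simp add: power_mult_distrib power_even_eq)
    then have "qpoch_inf ((a * q ^ j)\<^sup>2) q * qpoch (a\<^sup>2) q (2 * j) = qpoch_inf (a\<^sup>2) q"
      using qpoch_inf_split[OF q_norm, of "a\<^sup>2" "2 * j"] by (simp only: mult.commute)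
    also have "\<dots> = qpoch (a\<^sup>2) q j * qpoch_inf (a\<^sup>2 * q ^ j) q"
      by (rule qpoch_inf_split[OF q_norm])
    finally have 2: "qpoch_inf ((a * q ^ j)\<^sup>2) q * qpoch (a\<^sup>2) q (2 * j) =
        qpoch (a\<^sup>2) q j * qpoch_inf (a\<^sup>2 * q ^ j) q" .
    show ?thesis
      unfolding 1 mult.assoc[symmetric] 2 by (simp add: mult_ac)
  qed
  \<comment> \<open>Four reversed products of length \<open>j\<close>; their four signs \<open>(- 1) ^ j\<close> cancel.\<close>
  have Z: "qpoch (1 / q ^ j) q j * (\<Prod>e\<in>E - {a}. qpoch (e / a / q ^ j) q j) =
      (R / a ^ 3) ^ j / q ^ (4 * \<Sum>{..j}) * (qpoch q q j * Z)"
  proof -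
    \<comment> \<open>The product for \<open>a\<close> itself is the case \<open>x = 1\<close> of the reversal.\<close>
    have "qpoch (1 / q ^ j) q j = (- 1) ^ j / q ^ \<Sum>{..j} * qpoch q q j"
      using qpoch_reverse[of q 1 j] q_nonzero by simp
    moreover have "(\<Prod>e\<in>E - {a}. qpoch (e / a / q ^ j) q j) =
        (\<Prod>e\<in>E-{a}. (- (e / a)) ^ j / q ^ \<Sum>{..j} * qpoch (q * a / e) q j)"
    proof (intro prod.cong refl)
      fix e assume "e \<in> E - {a}"
      then have "e / a \<noteq> 0" using E_nonzero a0 by auto
      from qpoch_reverse[OF q_nonzero this, of j]
      show "qpoch (e / a / q ^ j) q j = (- (e / a)) ^ j / q ^ \<Sum>{..j} * qpoch (q * a / e) q j"
        by (simp only: divide_divide_eq_right)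
    qed
    moreover have "\<dots> = (- 1) ^ j * (R / a ^ 3) ^ j / (q ^ \<Sum>{..j}) ^ 3 * Z"
    proof -
      have "(\<Prod>e\<in>E-{a}. (- (e / a)) ^ j) = (\<Prod>e\<in>E-{a}. - (e / a)) ^ j"
        by (simp add: prod_power_distrib)
      also have "(\<Prod>e\<in>E-{a}. - (e / a)) = - (R / a ^ 3)"
        by (simp add: prod_uminus prod_dividef card3 R_def)
      also have "(- (R / a ^ 3)) ^ j = (- 1) ^ j * (R / a ^ 3) ^ j"
        by (rule power_minus)
      finally show ?thesis
        by (simp only: prod.distrib prod_dividef prod_constant card3 Z_def)
    qed
    moreover have "q ^ (4 * \<Sum>{..j}) = q ^ \<Sum>{..j} * (q ^ \<Sum>{..j}) ^ 3"
      by (simp add: mult.commute[of 4] power_mult power4_eq_xxxx power3_eq_cube)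
    moreover have "(- 1) ^ j * (- 1) ^ j = (1 :: complex)"
      by (simp flip: power_mult_distrib)
    ultimately show ?thesis by simp
  qed
  \<comment> \<open>Comparison of the monomials of numerator and denominator; only \<open>q / \<Prod>E\<close> survives.\<close>
  have scale: "1 / (a ^ 4) ^ j / q ^ \<Sum>{..2 * j} =
      (q / \<Prod>E) ^ j * ((R / a ^ 3) ^ j / q ^ (4 * \<Sum>{..j}))"
  proof -
    have "q ^ (4 * \<Sum>{..j}) = q ^ \<Sum>{..2 * j} * q ^ j"
      by (simp flip: sum_atMost_double power_add)
    moreover have "1 / (a ^ 4) ^ j = (1 / \<Prod>E) ^ j * (R / a ^ 3) ^ j"
    proof -
      have "1 / a ^ 4 = 1 / \<Prod>E * (R / a ^ 3)"
        using R0 a0 by (simp add: prodE eval_nat_numeral)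
      then show ?thesis by (simp only: power_mult_distrib power_one_over[symmetric])
    qed
    ultimately show ?thesis
      using q_nonzero by (simp add: power_divide)
  qed
  have rev: "qpoch (1 / a\<^sup>2 / q ^ (2 * j)) q (2 * j) =
      1 / (a ^ 4) ^ j / q ^ \<Sum>{..2 * j} * qpoch (q * a\<^sup>2) q (2 * j)"
    using qpoch_reverse[of q "1 / a\<^sup>2" "2 * j"] q_nonzero a0
    by (simp add: power_mult power_divide)
  define s where "s = (R / a ^ 3) ^ j / q ^ (4 * \<Sum>{..j})"
  define w where "w = qpoch (a\<^sup>2) q j * ((1 - a\<^sup>2 * q ^ (2 * j)) / (1 - a\<^sup>2))"
  define I where "I = qpoch_inf (a\<^sup>2 * q ^ j) q"
  define Q where "Q = qpoch q q j"
  have nz: "s \<noteq> 0" "I \<noteq> 0"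
    using R0 a0 q_nonzero qpoch_inf_products[OF a a, of j]
    by (simp_all add: s_def I_def power2_eq_square)
  have "residue_head m a j = (a * q ^ j) ^ m *
      (qpoch_inf ((a * q ^ j)\<^sup>2) q * qpoch (q * a\<^sup>2) q (2 * j)) * (1 / (a ^ 4) ^ j / q ^ \<Sum>{..2 * j}) /
      (I * X * (qpoch (1 / q ^ j) q j * (\<Prod>e\<in>E - {a}. qpoch (e / a / q ^ j) q j)))"
    unfolding residue_head_def rev allX I_def by (simp only: mult_ac)
  also have "\<dots> = (a * q ^ j) ^ m * (w * I) * ((q / \<Prod>E) ^ j * s) / (I * X * (s * (Q * Z)))"
    unfolding wp Z scale by (simp only: s_def w_def I_def Q_def)
  also have "\<dots> = (a * q ^ j) ^ m * (q / \<Prod>E) ^ j * w / (X * (Q * Z))"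
    using nz by simp
  also have "(a * q ^ j) ^ m * (q / \<Prod>E) ^ j = a ^ m * (q ^ (m + 1) / \<Prod>E) ^ j"
  proof -
    have "(q ^ j) ^ m = (q ^ m) ^ j"
      by (simp only: mult.commute[of j] power_mult[symmetric])
    moreover have "q ^ (m + 1) / \<Prod>E = q ^ m * (q / \<Prod>E)"
      by simp
    ultimately show ?thesis by (simp only: power_mult_distrib mult.assoc)
  qed
  also have "a ^ m * (q ^ (m + 1) / \<Prod>E) ^ j * w / (X * (Q * Z)) =
      a ^ m / (Y * X) * (w * Y / (Q * Z) * (q ^ (m + 1) / \<Prod>E) ^ j)"
    using Y0 by simp
  finally show ?thesis
    unfolding series_coeff_def XY w_def Y_def Z_def Q_def .
qed

lemma summable_series:
  assumes "a \<in> E" "norm (q ^ (m + 1) / \<Prod>E) < 1"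
  shows "summable (\<lambda>j. norm (series_coeff a j * (q ^ (m + 1) / \<Prod>E) ^ j))"
  using convergent_series_coeff[OF assms(1)] assms(2) by (rule summable_norm_convergent_mult_power)

text \<open>
  The limit of the sum of the residues at \<open>a * q ^ j\<close> with \<open>j < N\<close>; up to the factor \<open>qpoch_inf q q\<close> this is
  \<open>F_k\<close>, by \<open>aw_F_eq_residue_sum\<close>.
\<close>
definition residue_sum :: "nat \<Rightarrow> complex \<Rightarrow> complex" where
  "residue_sum m a = a ^ m / (\<Prod>e\<in>E-{a}. qpoch_inf (a * e) q) * residue_tail_limit a *
     (\<Sum>j. series_coeff a j * (q ^ (m + 1) / \<Prod>E) ^ j)"

lemma truncated_residue_sum_tendsto:
  assumes "a \<in> E" "norm (q ^ (m + 1) / \<Prod>E) < 1"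
  shows "(\<lambda>N. \<Sum>j<N. residue_head m a j * residue_tail a (N - j)) \<longlonglongrightarrow> residue_sum m a"
proof -
  define C where "C = a ^ m / (\<Prod>e\<in>E-{a}. qpoch_inf (a * e) q)"
  define t where "t j = series_coeff a j * (q ^ (m + 1) / \<Prod>E) ^ j" for j
  have t: "summable (\<lambda>j. norm (t j))"
    unfolding t_def by (rule summable_series[OF assms])
  have res: "residue_head m a = (\<lambda>j. C * t j)"
    unfolding C_def t_def using residue_head_eq[OF assms(1)] by (intro ext)
  have "(\<lambda>N. \<Sum>j<N. residue_head m a j * residue_tail a (N - j)) \<longlonglongrightarrow>
      suminf (residue_head m a) * residue_tail_limit a"
    by (rule tannery_convolution[OF _ residue_tail_tendsto[OF assms(1)]])
       (simp add: res norm_mult summable_mult t)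
  also have "suminf (residue_head m a) = C * suminf t"
    unfolding res by (rule suminf_mult) (rule summable_norm_cancel[OF t])
  also have "C * suminf t * residue_tail_limit a = residue_sum m a"
    unfolding residue_sum_def C_def[symmetric] t_def[symmetric] by (simp only: mult_ac)
  finally show ?thesis .
qed

end

lemma (in aw_params) aw_F_eq_residue_sum:
  assumes E: "E = {a, b, c, d}" and dist: "distinct [a, b, c, d]"
  shows "aw_F q n k a b c d = qpoch_inf q q * residue_sum (absdiff n k) a"
proof -
  have a: "a \<in> E" and a0: "a \<noteq> 0" using E E_nonzero by auto
  have Ea: "E - {a} = {b, c, d}" using E dist by auto
  have prodE: "\<Prod>E = a * b * c * d" using dist by (simp add: E mult_ac)
  have qq: "qpoch_inf q q \<noteq> 0"
    using q_power_Suc_neq_1 by (simp add: qpoch_inf_zero_iff)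
  have nz: "a\<^sup>2 * q ^ (2 * i) \<noteq> 1" for i
    using products[OF a a] by (simp add: power2_eq_square)
  define s where "s = csqrt (a\<^sup>2)"
  have s: "s\<^sup>2 = a\<^sup>2" by (simp add: s_def)
  have coeff: "qpochs [a\<^sup>2, q * s, - q * s, a * b, a * c, a * d] q j /
      qpochs [q, s, - s, q * a\<^sup>2 / (a * b), q * a\<^sup>2 / (a * c), q * a\<^sup>2 / (a * d)] q j =
      series_coeff a j" for j
  proof -
    have simplified: "q * a\<^sup>2 / (a * x) = q * a / x" for x
      using a0 by (simp add: power2_eq_square)
    show ?thesis
      unfolding simplified series_coeff_def very_well_poised_ratio[OF s nz, symmetric] Ea
      using dist by (simp add: qpochs_def mult_ac)
  qed
  have "W65 (a\<^sup>2) (a * b) (a * c) (a * d) q (q ^ (1 + absdiff n k) / (a * b * c * d)) =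
      (\<Sum>j. series_coeff a j * (q ^ (absdiff n k + 1) / \<Prod>E) ^ j)"
    unfolding W65_def qhyp_def s_def[symmetric] coeff prodE by simp
  then show ?thesis
    unfolding aw_F_def residue_sum_def residue_tail_limit_def Ea
    using qq dist by (simp add: qpochs_inf_def mult_ac)
qed

section \<open>The residue theorem for the truncated weight\<close>

text \<open>
  A closed path that separates the points \<open>e * q ^ j\<close> from their reciprocals. This is the
  condition \<open>aw_contour\<close>, for a set of parameters.
\<close>
locale aw_loop = aw_params +
  fixes \<gamma> :: "real \<Rightarrow> complex"
  assumes valid: "valid_path \<gamma>" and loop: "pathfinish \<gamma> = pathstart \<gamma>"
    and zero_notin: "0 \<notin> path_image \<gamma>" and winding_0: "winding_number \<gamma> 0 = 1"
    and inner_notin: "\<And>e j. e \<in> E \<Longrightarrow> e * q ^ j \<notin> path_image \<gamma>"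
    and outer_notin: "\<And>e j. e \<in> E \<Longrightarrow> 1 / (e * q ^ j) \<notin> path_image \<gamma>"
    and winding_inner: "\<And>e j. e \<in> E \<Longrightarrow> winding_number \<gamma> (e * q ^ j) = 1"
    and winding_outer: "\<And>e j. e \<in> E \<Longrightarrow> winding_number \<gamma> (1 / (e * q ^ j)) = 0"
begin

definition denom :: "complex \<Rightarrow> complex" where
  "denom z = (\<Prod>e\<in>E. qpoch_inf (e * z) q * qpoch_inf (e / z) q)"

definition regular :: "complex set" where
  "regular = {z. z \<noteq> 0 \<and> denom z \<noteq> 0}"

lemma holomorphic_denom: "denom holomorphic_on - {0}"
  unfolding denom_def [abs_def] by (intro holomorphic_intros) auto

lemma open_regular: "open regular"
proof -
  have "open (- {0} \<inter> denom -` (- {0}))"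
    by (rule continuous_open_preimage[OF holomorphic_on_imp_continuous_on[OF holomorphic_denom]]) auto
  also have "- {0} \<inter> denom -` (- {0}) = regular"
    by (auto simp: regular_def)
  finally show ?thesis .
qed

lemma path_image_regular: "path_image \<gamma> \<subseteq> regular"
proof
  fix z assume z: "z \<in> path_image \<gamma>"
  then have z0: "z \<noteq> 0" using zero_notin by auto
  have "z \<notin> outer_poles"
    using z outer_notin by (auto simp: outer_poles_def)
  moreover have "qpoch_inf (e / z) q \<noteq> 0" if "e \<in> E" for e
  proof
    assume "qpoch_inf (e / z) q = 0"
    then obtain j where "e / z * q ^ j = 1" by (auto simp: qpoch_inf_zero_iff)
    then have "z = e * q ^ j" using z0 by (simp add: field_simps)
    with inner_notin[OF that] z show False by auto
  qed
  ultimately show "z \<in> regular"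
    using z0 finite_E by (auto simp: regular_def denom_def outer_poles_iff)
qed

lemma truncated_denom_nonzero:
  assumes "z \<in> regular"
  shows "(\<Prod>e\<in>E. qpoch_inf (e * z) q * qpoch (e / z) q N) \<noteq> 0"
proof -
  have "qpoch_inf (e * z) q \<noteq> 0 \<and> qpoch_inf (e / z) q \<noteq> 0" if "e \<in> E" for e
    using assms that finite_E by (auto simp: regular_def denom_def)
  moreover have "qpoch (e / z) q N \<noteq> 0" if "qpoch_inf (e / z) q \<noteq> 0" for e
    using that qpoch_inf_split[OF q_norm, of "e / z" N] by auto
  ultimately show ?thesis
    using finite_E by simp
qed

lemma holomorphic_truncated: "(\<lambda>z. truncated_weight q E N z * z ^ m / z) holomorphic_on regular"
  unfolding truncated_weight_def
  by (intro holomorphic_intros) (use truncated_denom_nonzero in \<open>auto simp: regular_def\<close>)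

lemma holomorphic_weight: "(\<lambda>z. weight q E z * z ^ m / z) holomorphic_on regular"
  unfolding weight_def denom_def [symmetric]
  by (intro holomorphic_intros holomorphic_on_subset[OF holomorphic_denom]) (auto simp: regular_def)

lemma truncated_uniform_limit:
  assumes K: "compact K" "K \<subseteq> regular"
  shows "uniform_limit K (\<lambda>N z. truncated_weight q E N z * z ^ m / z)
           (\<lambda>z. weight q E z * z ^ m / z) sequentially"
proof -
  have K0: "K \<subseteq> - {0}" using K by (auto simp: regular_def)
  have bd: "bounded (f ` K)" if "f holomorphic_on - {0}" for f :: "complex \<Rightarrow> complex"
    using K(1) holomorphic_on_imp_continuous_on[OF holomorphic_on_subset[OF that K0]]
    by (intro compact_imp_bounded compact_continuous_image)
  have num_hol: "(\<lambda>z. qpoch_inf (z\<^sup>2) q * qpoch_inf (1 / z\<^sup>2) q) holomorphic_on - {0}"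
    by (intro holomorphic_intros) auto
  \<comment> \<open>The truncated factors are polynomials in these two functions, which are continuous away from
    \<open>0\<close>; this transfers the uniform convergence of q-shifted factorials on compact sets.\<close>
  have cont: "continuous_on K (\<lambda>z. 1 / z\<^sup>2)" "\<And>e. continuous_on K (\<lambda>z. e / z)"
    using K0 by (auto intro!: continuous_intros)
  have "uniform_limit K (\<lambda>N z. qpoch (1 / z\<^sup>2) q (2 * N)) (\<lambda>z. qpoch_inf (1 / z\<^sup>2) q) sequentially"
    by (rule filterlim_compose[OF qpoch_uniform_limit_compose[OF q_norm K(1) cont(1)]])
       (rule mult_nat_left_at_top, simp)
  then have num: "uniform_limit K (\<lambda>N z. qpoch_inf (z\<^sup>2) q * qpoch (1 / z\<^sup>2) q (2 * N))
      (\<lambda>z. qpoch_inf (z\<^sup>2) q * qpoch_inf (1 / z\<^sup>2) q) sequentially"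
    by (intro uniform_lim_mult uniform_limit_const bd holomorphic_intros) auto
  have den: "uniform_limit K (\<lambda>N z. \<Prod>e\<in>E. qpoch_inf (e * z) q * qpoch (e / z) q N) denom sequentially"
    unfolding denom_def [abs_def]
  proof (rule uniform_lim_prod[OF finite_E, THEN conjunct1])
    fix e
    show "uniform_limit K (\<lambda>N z. qpoch_inf (e * z) q * qpoch (e / z) q N)
        (\<lambda>z. qpoch_inf (e * z) q * qpoch_inf (e / z) q) sequentially"
      by (intro uniform_lim_mult uniform_limit_const bd holomorphic_intros
            qpoch_uniform_limit_compose q_norm K cont) auto
    show "bounded ((\<lambda>z. qpoch_inf (e * z) q * qpoch_inf (e / z) q) ` K)"
      by (intro bd holomorphic_intros) auto
  qed
  \<comment> \<open>Quotients converge uniformly because the limit of the denominators is bounded away from \<open>0\<close>.\<close>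
  have comp: "compact (denom ` K)"
    using K(1) holomorphic_on_imp_continuous_on[OF holomorphic_on_subset[OF holomorphic_denom K0]]
    by (intro compact_continuous_image)
  have "0 \<notin> denom ` K"
    using K(2) by (auto simp: regular_def)
  from separate_point_closed[OF compact_imp_closed[OF comp] this]
  obtain b where b: "b > 0" "\<And>w. w \<in> denom ` K \<Longrightarrow> b \<le> dist 0 w"
    by auto
  have "uniform_limit K (truncated_weight q E) (weight q E) sequentially"
    unfolding truncated_weight_def [abs_def] weight_def [abs_def] denom_def [symmetric]
    using b by (intro uniform_lim_divide[OF num den bd[OF num_hol], of b]) auto
  moreover have "bounded (weight q E ` K)"
  proof -
    have "continuous_on K (weight q E)"
      unfolding weight_def [abs_def] denom_def [symmetric]
      using K(2)
      by (intro holomorphic_on_imp_continuous_on holomorphic_intros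
           holomorphic_on_subset[OF holomorphic_denom K0]) (auto simp: regular_def)
    with K(1) show ?thesis
      by (intro compact_imp_bounded compact_continuous_image)
  qed
  moreover have "bounded ((\<lambda>z. z ^ m / z) ` K)"
    by (intro bd holomorphic_intros) auto
  ultimately have "uniform_limit K (\<lambda>N z. truncated_weight q E N z * (z ^ m / z))
      (\<lambda>z. weight q E z * (z ^ m / z)) sequentially"
    by (intro uniform_lim_mult uniform_limit_const)
  then show ?thesis by simp
qed

text \<open>
  Both integrands are holomorphic on \<open>regular\<close>, so the loop may be replaced by a nearby
  polynomial one, for which uniform convergence of the integrands suffices.
\<close>
lemma contour_integral_truncated_tendsto:
  "(\<lambda>N. contour_integral \<gamma> (\<lambda>z. truncated_weight q E N z * z ^ m / z)) \<longlonglongrightarrow>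
     contour_integral \<gamma> (\<lambda>z. weight q E z * z ^ m / z)"
proof -
  obtain p where p: "polynomial_function p" "valid_path p" "path_image p \<subseteq> regular"
    and eq: "\<And>f. f holomorphic_on regular \<Longrightarrow> contour_integral p f = contour_integral \<gamma> f"
    using polynomial_replacement_of_loop[OF open_regular valid loop path_image_regular] by blast
  obtain p' where p': "polynomial_function p'" "\<And>t. (p has_vector_derivative p' t) (at t)"
    using has_vector_derivative_polynomial_function[OF p(1)] by metis
  have "bounded (p' ` {0..1})"
    using p'(1) by (intro compact_imp_bounded compact_continuous_image continuous_on_polymonial_function) auto
  then obtain B where B: "\<forall>t\<in>{0..1}. norm (p' t) \<le> B"
    by (auto simp: bounded_iff)
  have "(\<lambda>N. contour_integral p (\<lambda>z. truncated_weight q E N z * z ^ m / z)) \<longlonglongrightarrow>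
     contour_integral p (\<lambda>z. weight q E z * z ^ m / z)"
  proof (rule contour_integral_uniform_limit(2))
    show "uniform_limit (path_image p) (\<lambda>N z. truncated_weight q E N z * z ^ m / z)
        (\<lambda>z. weight q E z * z ^ m / z) sequentially"
      using p by (intro truncated_uniform_limit compact_valid_path_image)
    show "norm (vector_derivative p (at t)) \<le> B" if "t \<in> {0..1}" for t
      using B that p'(2)[of t] by (simp add: vector_derivative_at)
    show "\<forall>\<^sub>F N in sequentially. (\<lambda>z. truncated_weight q E N z * z ^ m / z) contour_integrable_on p"
      using p by (intro always_eventually allI
         contour_integrable_holomorphic_simple[OF holomorphic_truncated open_regular])
  qed (use p in auto)
  then show ?thesis
    by (simp add: eq holomorphic_truncated holomorphic_weight)
qed

text \<open>
  The domain is the complement of the closed set \<open>outer_poles\<close>, whose points have winding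
  number 0. The finitely many singularities in it, including \<open>0\<close>, all have winding number 1.
\<close>
lemma contour_integral_truncated:
  "contour_integral \<gamma> (\<lambda>z. truncated_weight q E N z * z ^ m / z) =
     2 * pi * \<i> * (0 ^ m * (q / \<Prod>E) ^ N +
       (\<Sum>a\<in>E. \<Sum>j<N. residue_head m a j * residue_tail a (N - j)))"
proof -
  define f where "f z = truncated_weight q E N z * z ^ m / z" for z
  define P where "P = (\<lambda>(e,j). e * q ^ j) ` (E \<times> {..<N})"
  have fin: "finite P" using finite_E by (simp add: P_def)
  have P0: "0 \<notin> P" using E_nonzero q_nonzero by (auto simp: P_def)
  have "contour_integral \<gamma> f = 2 * pi * \<i> *
      (\<Sum>p\<in>insert 0 P. winding_number \<gamma> p * residue f p)"
  proof (rule Residue_theorem[OF open_Compl_outer_poles connected_Compl_outer_poles _ _ valid loop])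
    show "f holomorphic_on - outer_poles - insert 0 P"
      unfolding f_def truncated_weight_def
    proof (intro holomorphic_intros)
      fix z assume z: "z \<in> - outer_poles - insert 0 P"
      have "qpoch (e / z) q N \<noteq> 0" if "e \<in> E" for e
      proof
        assume "qpoch (e / z) q N = 0"
        then obtain j where "j < N" "e / z * q ^ j = 1" by (auto simp: qpoch_eq_0_iff)
        moreover from this have "z = e * q ^ j" using z by (auto simp: field_simps)
        ultimately have "z \<in> P" using that by (auto simp: P_def)
        with z show False by simp
      qed
      then show "(\<Prod>e\<in>E. qpoch_inf (e * z) q * qpoch (e / z) q N) \<noteq> 0"
        using z finite_E by (auto simp: outer_poles_iff)
    qed auto
    show "path_image \<gamma> \<subseteq> - outer_poles - insert 0 P"
      using zero_notin outer_notin inner_notin by (fastforce simp: outer_poles_def P_def)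
    show "\<forall>z. z \<notin> - outer_poles \<longrightarrow> winding_number \<gamma> z = 0"
      using winding_outer by (auto simp: outer_poles_def)
  qed (use fin in auto)
  also have "(\<Sum>p\<in>insert 0 P. winding_number \<gamma> p * residue f p) = (\<Sum>p\<in>insert 0 P. residue f p)"
    using winding_0 winding_inner by (intro sum.cong) (auto simp: P_def)
  also have "\<dots> = residue f 0 + (\<Sum>p\<in>P. residue f p)"
    using fin P0 by simp
  also have "(\<Sum>p\<in>P. residue f p) = (\<Sum>(e,j)\<in>E \<times> {..<N}. residue f (e * q ^ j))"
    unfolding P_def
  proof (subst sum.reindex)
    show "inj_on (\<lambda>(e, j). e * q ^ j) (E \<times> {..<N})"
    proof (intro inj_onI, clarify)
      fix e i e' i' assume *: "e \<in> E" "e' \<in> E" "e * q ^ i = e' * q ^ i'"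
      then have "e = e'" using separated by blast
      moreover from this * have "i = i'" using E_nonzero q_power_inj by auto
      ultimately show "e = e' \<and> i = i'" by simp
    qed
  qed (simp add: case_prod_unfold)
  also have "\<dots> = (\<Sum>e\<in>E. \<Sum>j<N. residue f (e * q ^ j))"
    by (rule sum.cartesian_product[symmetric])
  also have "\<dots> = (\<Sum>a\<in>E. \<Sum>j<N. residue_head m a j * residue_tail a (N - j))"
    unfolding f_def by (intro sum.cong refl truncated_weight_residue) auto
  also have "residue f 0 = 0 ^ m * (q / \<Prod>E) ^ N"
    unfolding f_def by (rule truncated_weight_residue_0)
  finally show ?thesis by (simp add: f_def)
qed

lemma contour_integral_weight:
  assumes conv: "norm (q ^ (m + 1) / \<Prod>E) < 1"
  shows "contour_integral \<gamma> (\<lambda>z. weight q E z * z ^ m / z) =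
     2 * pi * \<i> * (\<Sum>a\<in>E. residue_sum m a)"
proof -
  have "(\<lambda>N. 0 ^ m * (q / \<Prod>E) ^ N) \<longlonglongrightarrow> 0"
  proof (cases "m = 0")
    case True
    with conv show ?thesis by (simp add: LIMSEQ_power_zero)
  next
    case False
    then show ?thesis by (simp add: power_0_left)
  qed
  then have lim: "(\<lambda>N. 2 * pi * \<i> * (0 ^ m * (q / \<Prod>E) ^ N +
       (\<Sum>a\<in>E. \<Sum>j<N. residue_head m a j * residue_tail a (N - j)))) \<longlonglongrightarrow>
      2 * pi * \<i> * (0 + (\<Sum>a\<in>E. residue_sum m a))"
    by (intro tendsto_intros truncated_residue_sum_tendsto conv)
  show ?thesis
    using LIMSEQ_unique[OF contour_integral_truncated_tendsto[of m, unfolded contour_integral_truncated] lim]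
    by simp
qed

end

section \<open>Inversion of the contour and the moments\<close>

lemma power_mult_inverse_power:
  fixes z :: "'a :: field"
  assumes "k \<le> n" "z \<noteq> 0"
  shows "z ^ k * (1 / z) ^ (n - k) = (if n \<le> 2 * k then z else 1 / z) ^ absdiff n k"
proof (cases "n \<le> 2 * k")
  case True
  then have "absdiff n k + (n - k) = k"
    using assms by (auto simp: absdiff_def)
  then have "z ^ k = z ^ absdiff n k * z ^ (n - k)"
    using power_add[of z "absdiff n k" "n - k"] by (simp only:)
  then show ?thesis using True assms by (simp add: power_divide)
next
  case False
  then have "n - k = absdiff n k + k"
    using assms by (auto simp: absdiff_def)
  then have "(1 / z) ^ (n - k) = (1 / z) ^ absdiff n k * (1 / z) ^ k" by (metis power_add)
  then show ?thesis using False assms by (simp add: power_divide)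
qed

context aw_loop
begin

text \<open>The reversal restores the winding number 1 around \<open>0\<close>, which inversion changes to -1.\<close>
definition inverted_path :: "real \<Rightarrow> complex" where
  "inverted_path = reversepath (inverse \<circ> \<gamma>)"

lemma inverse_analytic: "(inverse :: complex \<Rightarrow> complex) analytic_on - {0}"
  using analytic_on_inverse[OF analytic_on_ident[of "- {0}"]] by auto

lemma valid_inverse: "valid_path (inverse \<circ> \<gamma>)"
proof (rule valid_path_compose_analytic[OF valid, of _ "- {0}"])
  show "path_image \<gamma> \<subseteq> - {0}" using zero_notin by auto
qed (rule inverse_analytic)

lemma contour_integral_inverted:
  "contour_integral inverted_path f = contour_integral \<gamma> (\<lambda>w. f (1 / w) / w\<^sup>2)"
proof -
  have "contour_integral inverted_path f = - contour_integral (inverse \<circ> \<gamma>) f"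
    unfolding inverted_path_def by (rule contour_integral_reversepath[OF valid_inverse])
  also have "contour_integral (inverse \<circ> \<gamma>) f =
      contour_integral \<gamma> (\<lambda>w. deriv inverse w * f (inverse w))"
    using zero_notin by (intro contour_integral_comp_analyticW[OF inverse_analytic valid]) auto
  also have "\<dots> = contour_integral \<gamma> (\<lambda>w. - (f (1 / w) / w\<^sup>2))"
  proof (rule contour_integral_cong[OF refl])
    fix w assume "w \<in> path_image \<gamma>"
    then have "w \<noteq> 0" using zero_notin by auto
    then have "deriv inverse w = - (1 / w\<^sup>2)"
      by (intro DERIV_imp_deriv) (auto intro!: derivative_eq_intros simp: power2_eq_square field_simps)
    then show "deriv inverse w * f (inverse w) = - (f (1 / w) / w\<^sup>2)"
      by (simp add: inverse_eq_divide)
  qed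
  finally show ?thesis by (simp add: contour_integral_neg)
qed

lemma path_image_inverted: "path_image inverted_path = inverse ` path_image \<gamma>"
  unfolding inverted_path_def by (simp add: path_image_compose)

lemma notin_inverted: "z \<in> path_image inverted_path \<longleftrightarrow> 1 / z \<in> path_image \<gamma>"
  unfolding path_image_inverted inverse_eq_divide by (force simp: image_iff)

lemma valid_inverted: "valid_path inverted_path"
  unfolding inverted_path_def using valid_inverse by simp

lemma winding_inverted_0: "winding_number inverted_path 0 = 1"
proof -
  have "contour_integral inverted_path (\<lambda>w. 1 / (w - 0)) = contour_integral \<gamma> (\<lambda>w. 1 / (w - 0))"
    unfolding contour_integral_inverted using zero_notin
    by (intro contour_integral_cong) (auto simp: power2_eq_square)
  then have "winding_number inverted_path 0 = winding_number \<gamma> 0"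
    using zero_notin by (simp add: winding_number_valid_path valid valid_inverted notin_inverted)
  with winding_0 show ?thesis by simp
qed

text \<open>
  Under the substitution \<open>w = 1 / u\<close> the form \<open>dw / (w - z)\<close> becomes, up to the sign absorbed by
  the reversal, \<open>du / u - du / (u - 1 / z)\<close>.
\<close>
lemma winding_inverted:
  assumes "z \<noteq> 0" "1 / z \<notin> path_image \<gamma>"
  shows "winding_number inverted_path z = 1 - winding_number \<gamma> (1 / z)"
proof -
  have "contour_integral inverted_path (\<lambda>w. 1 / (w - z)) =
      contour_integral \<gamma> (\<lambda>w. 1 / (w - 0) - 1 / (w - 1 / z))"
    unfolding contour_integral_inverted
  proof (rule contour_integral_cong[OF refl])
    fix w assume w: "w \<in> path_image \<gamma>"
    then have "w \<noteq> 0" "w \<noteq> 1 / z" using zero_notin assms by auto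
    then have "w * z \<noteq> 1" using assms by (auto simp: field_simps)
    then have "1 - w * z \<noteq> 0" "w * z - 1 \<noteq> 0" by auto
    have "1 / w - z = (1 - w * z) / w"
      using \<open>w \<noteq> 0\<close> by (simp add: diff_divide_distrib)
    then have "1 / (1 / w - z) / w\<^sup>2 = 1 / (w * (1 - w * z))"
      using \<open>w \<noteq> 0\<close> by (simp add: power2_eq_square)
    also have "\<dots> = 1 / w - z / (w * z - 1)"
      using \<open>w \<noteq> 0\<close> \<open>1 - w * z \<noteq> 0\<close> \<open>w * z - 1 \<noteq> 0\<close> by (simp add: divide_simps)
    also have "z / (w * z - 1) = 1 / (w - 1 / z)"
      using assms by (simp add: field_simps)
    finally show "1 / (1 / w - z) / w\<^sup>2 = 1 / (w - 0) - 1 / (w - 1 / z)"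
      by simp
  qed
  also have "\<dots> = contour_integral \<gamma> (\<lambda>w. 1 / (w - 0)) - contour_integral \<gamma> (\<lambda>w. 1 / (w - 1 / z))"
    by (intro contour_integral_diff contour_integrable_inversediff valid zero_notin assms)
  finally have "winding_number inverted_path z = winding_number \<gamma> 0 - winding_number \<gamma> (1 / z)"
    using assms zero_notin
    by (simp add: winding_number_valid_path valid valid_inverted notin_inverted diff_divide_distrib)
  with winding_0 show ?thesis by simp
qed

text \<open>
  Inversion exchanges the points \<open>e * q ^ j\<close> with their reciprocals, and \<open>winding_inverted\<close>
  exchanges the winding numbers 1 and 0.
\<close>
lemma aw_loop_inverted: "aw_loop q E inverted_path"
proof (intro aw_loop.intro aw_params_axioms aw_loop_axioms.intro)
  show "valid_path inverted_path"
    by (rule valid_inverted)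
  show "pathfinish inverted_path = pathstart inverted_path"
    using loop by (simp add: inverted_path_def pathstart_compose pathfinish_compose)
  show "0 \<notin> path_image inverted_path"
    using zero_notin by (simp add: notin_inverted)
  show "winding_number inverted_path 0 = 1"
    by (rule winding_inverted_0)
next
  fix e j assume e: "e \<in> E"
  then have "e * q ^ j \<noteq> 0" using E_nonzero q_nonzero by auto
  show "e * q ^ j \<notin> path_image inverted_path"
    using outer_notin[OF e] by (simp add: notin_inverted)
  show "1 / (e * q ^ j) \<notin> path_image inverted_path"
    using inner_notin[OF e] by (simp add: notin_inverted)
  show "winding_number inverted_path (e * q ^ j) = 1"
    using winding_inverted[of "e * q ^ j"] outer_notin[OF e] winding_outer[OF e] \<open>e * q ^ j \<noteq> 0\<close>
    by simp
  show "winding_number inverted_path (1 / (e * q ^ j)) = 0"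
    using winding_inverted[of "1 / (e * q ^ j)"] inner_notin[OF e] winding_inner[OF e] \<open>e * q ^ j \<noteq> 0\<close>
    by simp
qed

lemma weight_inverse: "weight q E (1 / z) = weight q E z"
  by (simp add: weight_def power_divide mult_ac)

lemma contour_integral_weight_inverse:
  assumes conv: "norm (q ^ (m + 1) / \<Prod>E) < 1"
  shows "contour_integral \<gamma> (\<lambda>z. weight q E z * (1 / z) ^ m / z) =
     2 * pi * \<i> * (\<Sum>a\<in>E. residue_sum m a)"
proof -
  have "contour_integral inverted_path (\<lambda>z. weight q E z * z ^ m / z) =
     contour_integral \<gamma> (\<lambda>z. weight q E z * (1 / z) ^ m / z)"
    unfolding contour_integral_inverted weight_inverse using zero_notin
    by (intro contour_integral_cong) (auto simp: power2_eq_square)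
  then show ?thesis
    using aw_loop.contour_integral_weight[OF aw_loop_inverted conv] by simp
qed

lemma weight_contour_integrable:
  "(\<lambda>z. weight q E z * z ^ m / z) contour_integrable_on \<gamma>"
  "(\<lambda>z. weight q E z * (1 / z) ^ m / z) contour_integrable_on \<gamma>"
proof -
  show "(\<lambda>z. weight q E z * z ^ m / z) contour_integrable_on \<gamma>"
    by (rule contour_integrable_holomorphic_simple[OF holomorphic_weight open_regular valid path_image_regular])
  have "(\<lambda>z. (weight q E z * z ^ 0 / z) * (1 / z) ^ m) holomorphic_on regular"
    by (intro holomorphic_on_mult holomorphic_weight holomorphic_intros) (auto simp: regular_def)
  then show "(\<lambda>z. weight q E z * (1 / z) ^ m / z) contour_integrable_on \<gamma>"
    using contour_integrable_holomorphic_simple[OF _ open_regular valid path_image_regular] by simp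
qed

lemma contour_integral_moment:
  assumes conv: "\<And>k. k \<le> n \<Longrightarrow> norm (q ^ (absdiff n k + 1) / \<Prod>E) < 1"
  shows "contour_integral \<gamma> (\<lambda>z. weight q E z * ((z + 1 / z) / 2) ^ n / (\<i> * z)) =
     2 * pi / 2 ^ n * (\<Sum>k\<le>n. of_nat (n choose k) * (\<Sum>a\<in>E. residue_sum (absdiff n k) a))"
proof -
  \<comment> \<open>The \<open>k\<close>-th term of the binomial expansion, with the sign of the exponent \<open>2 * k - n\<close> moved into
    the base.\<close>
  define f where "f k z = weight q E z * (if n \<le> 2 * k then z else 1 / z) ^ absdiff n k / z" for k z
  have f_int: "f k contour_integrable_on \<gamma>" for k
    using weight_contour_integrable by (cases "n \<le> 2 * k") (simp_all add: f_def [abs_def])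
  have f_val: "contour_integral \<gamma> (f k) = 2 * pi * \<i> * (\<Sum>a\<in>E. residue_sum (absdiff n k) a)"
    if "k \<le> n" for k
    using contour_integral_weight[OF conv[OF that]] contour_integral_weight_inverse[OF conv[OF that]]
    by (cases "n \<le> 2 * k") (simp_all add: f_def [abs_def])
  have "contour_integral \<gamma> (\<lambda>z. weight q E z * ((z + 1 / z) / 2) ^ n / (\<i> * z)) =
     contour_integral \<gamma> (\<lambda>z. 1 / (2 ^ n * \<i>) * (\<Sum>k\<le>n. of_nat (n choose k) * f k z))"
  proof (rule contour_integral_cong[OF refl])
    fix z assume "z \<in> path_image \<gamma>"
    then have z: "z \<noteq> 0" using zero_notin by auto
    have "(z + 1 / z) ^ n = (\<Sum>k\<le>n. of_nat (n choose k) * z ^ k * (1 / z) ^ (n - k))"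
      by (rule binomial_ring)
    also have "\<dots> = (\<Sum>k\<le>n. of_nat (n choose k) * (if n \<le> 2 * k then z else 1 / z) ^ absdiff n k)"
      using power_mult_inverse_power[OF _ z] by (intro sum.cong refl) (simp add: mult.assoc)
    finally have "weight q E z / z * (z + 1 / z) ^ n = (\<Sum>k\<le>n. of_nat (n choose k) * f k z)"
      by (simp add: f_def sum_distrib_left mult_ac)
    moreover have "weight q E z * ((z + 1 / z) / 2) ^ n / (\<i> * z) =
        1 / (2 ^ n * \<i>) * (weight q E z / z * (z + 1 / z) ^ n)"
      by (simp add: power_divide mult_ac)
    ultimately show "weight q E z * ((z + 1 / z) / 2) ^ n / (\<i> * z) =
        1 / (2 ^ n * \<i>) * (\<Sum>k\<le>n. of_nat (n choose k) * f k z)"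
      by (simp only:)
  qed
  also have "\<dots> = 1 / (2 ^ n * \<i>) *
      contour_integral \<gamma> (\<lambda>z. \<Sum>k\<le>n. of_nat (n choose k) * f k z)"
    by (intro contour_integral_lmul contour_integrable_sum contour_integrable_lmul f_int) auto
  also have "contour_integral \<gamma> (\<lambda>z. \<Sum>k\<le>n. of_nat (n choose k) * f k z) =
      (\<Sum>k\<le>n. contour_integral \<gamma> (\<lambda>z. of_nat (n choose k) * f k z))"
    by (intro contour_integral_sum contour_integrable_lmul f_int) auto
  also have "\<dots> = (\<Sum>k\<le>n. of_nat (n choose k) * (2 * pi * \<i> * (\<Sum>a\<in>E. residue_sum (absdiff n k) a)))"
    by (intro sum.cong refl) (simp add: contour_integral_lmul f_int f_val)
  also have "\<dots> = 2 * pi * \<i> * (\<Sum>k\<le>n. of_nat (n choose k) * (\<Sum>a\<in>E. residue_sum (absdiff n k) a))"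
    by (simp only: sum_distrib_left mult_ac)
  finally show ?thesis by (simp add: field_simps)
qed

end

section \<open>Admissible contours\<close>

text \<open>
  The existence of an admissible contour forces \<open>products\<close>: if \<open>e * f * q ^ j = 1\<close>, then
  \<open>e * q ^ j\<close> is also the reciprocal of \<open>f\<close> and would need both winding numbers 1 and 0.
\<close>
lemma aw_loop_of_aw_contour:
  assumes q: "q \<noteq> 0" "norm q < 1"
    and nonzero: "a \<noteq> 0" "b \<noteq> 0" "c \<noteq> 0" "d \<noteq> 0"
    and ratios: "{a / b, a / c, a / d, b / c, b / d, c / d} \<inter> range (\<lambda>k::int. q powi k) = {}"
    and \<gamma>: "aw_contour q a b c d \<gamma>"
  shows "aw_loop q {a, b, c, d} \<gamma> \<and> distinct [a, b, c, d]"
proof -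
  have sep: "x * q ^ i \<noteq> y * q ^ j \<and> y * q ^ i \<noteq> x * q ^ j"
    if "x / y \<notin> range (\<lambda>k::int. q powi k)" "y \<noteq> 0" for x y i j
  proof -
    have "x * q ^ i \<noteq> y * q ^ j" for i j
    proof
      assume "x * q ^ i = y * q ^ j"
      then have "x / y = q powi (int j - int i)"
        using q that by (simp add: power_int_diff field_simps)
      with that show False by blast
    qed
    then show ?thesis by metis
  qed
  note s = sep[of a b] sep[of a c] sep[of a d] sep[of b c] sep[of b d] sep[of c d]
  have dist: "distinct [a, b, c, d]"
    using s[of 0 0] ratios nonzero by auto
  have inner: "e * q ^ j \<in> aw_inner_poles q a b c d" if "e \<in> {a, b, c, d}" for e j
    using that unfolding aw_inner_poles_def by blast
  have w: "winding_number \<gamma> (e * q ^ j) = 1" "winding_number \<gamma> (1 / (e * q ^ j)) = 0"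
     "e * q ^ j \<notin> path_image \<gamma>" "1 / (e * q ^ j) \<notin> path_image \<gamma>" if "e \<in> {a, b, c, d}" for e j
    using \<gamma> inner[OF that, of j] unfolding aw_contour_def by blast+
  have "aw_loop q {a, b, c, d} \<gamma>"
  proof unfold_locales
    show "card {a, b, c, d} = 4" using dist by simp
    show "e * q ^ i \<noteq> f * q ^ j" if "e \<in> {a, b, c, d}" "f \<in> {a, b, c, d}" "e \<noteq> f" for e f i j
      using that s[of i j] ratios nonzero by auto
    show "e * f * q ^ j \<noteq> 1" if e: "e \<in> {a, b, c, d}" and f: "f \<in> {a, b, c, d}" for e f j
    proof
      assume "e * f * q ^ j = 1"
      moreover have "f \<noteq> 0" using f nonzero by auto
      ultimately have "e * q ^ j = 1 / (f * q ^ 0)"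
        by (simp add: field_simps)
      with w(1)[OF e, of j] w(2)[OF f, of 0] show False by simp
    qed
  qed (use q nonzero \<gamma> w in \<open>auto simp: aw_contour_def\<close>)
  with dist show ?thesis by simp
qed

lemma circlepath_aw_contour:
  assumes q: "norm q < 1" and nonzero: "q \<noteq> 0" "a \<noteq> 0" "b \<noteq> 0" "c \<noteq> 0" "d \<noteq> 0"
    and small: "norm a < 1" "norm b < 1" "norm c < 1" "norm d < 1"
  shows "aw_contour q a b c d (circlepath 0 1)"
  unfolding aw_contour_def
proof (intro conjI ballI)
  fix p assume "p \<in> aw_inner_poles q a b c d"
  then obtain e j where e: "e \<in> {a, b, c, d}" "p = e * q ^ j"
    by (auto simp: aw_inner_poles_def)
  have "norm p \<le> norm e * 1"
    unfolding e(2) norm_mult norm_power using q by (intro mult_left_mono power_le_one) auto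
  then have p: "norm p < 1" using e small by auto
  have "p \<noteq> 0" using e nonzero by auto
  then have p': "norm (1 / p) > 1" using p by (simp add: norm_divide field_simps)
  show "p \<notin> path_image (circlepath 0 1)" "1 / p \<notin> path_image (circlepath 0 1)"
    using p p' by auto
  show "winding_number (circlepath 0 1) p = 1"
    using p by (intro winding_number_circlepath) auto
  show "winding_number (circlepath 0 1) (1 / p) = 0"
    using p' by (intro winding_number_zero_outside[of _ "cball 0 1"]) auto
qed (auto intro: winding_number_circlepath)

text \<open>
  The standard parametrization starts at angle 0; shifting it by half a turn gives the range from
  \<open>-pi\<close> to \<open>pi\<close> of the moment integral.
\<close>
lemma contour_integral_unit_circle:
  "contour_integral (circlepath 0 1) f = integral {-pi..pi} (\<lambda>t. f (cis t) * \<i> * cis t)"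
proof -
  have "shiftpath (1 / 2) (circlepath 0 1) = part_circlepath 0 1 (- pi) pi"
  proof
    fix t :: real
    have "exp (\<i> * (2 * pi * t + pi)) = exp (\<i> * (2 * pi * t - pi))"
    proof -
      have "\<i> * (2 * pi * t + pi) = \<i> * (2 * pi * t - pi) + 2 * complex_of_real pi * \<i>"
        by (simp add: algebra_simps)
      then show ?thesis by (simp only: exp_add exp_two_pi_i mult_1_right)
    qed
    then show "shiftpath (1 / 2) (circlepath 0 1) t = part_circlepath 0 1 (- pi) pi t"
      by (simp add: shiftpath_def circlepath part_circlepath_def linepath_def algebra_simps)
  qed
  moreover have "contour_integral (shiftpath (1 / 2) (circlepath 0 1)) f = contour_integral (circlepath 0 1) f"
    by (intro contour_integral_shiftpath) auto
  ultimately show ?thesis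
    by (simp add: contour_integral_part_circlepath_eq)
qed

lemma aw_moment_eq_contour_moment:
  "aw_moment q a b c d n = aw_contour_moment (circlepath 0 1) q a b c d n"
proof -
  have cos: "(cis t + 1 / cis t) / 2 = of_real (cos t)" for t
  proof -
    have "1 / cis t = cis (- t)"
      by (simp only: divide_inverse mult_1_left cis_inverse)
    then show ?thesis
      by (simp only:) (rule complex_eqI; simp)
  qed
  have "aw_weight q a b c d (cis t) * ((cis t + 1 / cis t) / 2) ^ n / (\<i> * cis t) * \<i> * cis t =
      aw_weight q a b c d (cis t) * of_real (cos t ^ n)" for t
    unfolding cos by simp
  then show ?thesis
    unfolding aw_moment_def aw_contour_moment_def contour_integral_unit_circle by (simp only:)
qed

section \<open>The moment formula\<close>

theorem theorem3p1:
  fixes n :: nat and q a b c d :: complex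
  assumes q: "0 < cmod q" "cmod q < 1"
    and nonzero: "a \<noteq> 0" "b \<noteq> 0" "c \<noteq> 0" "d \<noteq> 0"
    and params: "{a, b, c, d} \<inter> range (\<lambda>k::nat. 1 / q ^ k) = {}"
    and ratios: "{a / b, a / c, a / d, b / c, b / d, c / d} \<inter> range (\<lambda>k::int. q powi k) = {}"
    and convergence: "\<forall>k\<le>n. cmod (q ^ (1 + absdiff n k) / (a * b * c * d)) < 1"
  shows
    "let \<mu> = qpochs_inf [a * b, a * c, a * d, b * c, b * d, c * d] q
               / (2 ^ (n + 1) * qpoch_inf (a * b * c * d) q) *
             (\<Sum>k=0..n. of_nat (n choose k) *
               (aw_F q n k a b c d + aw_F q n k b a c d + aw_F q n k c b a d + aw_F q n k d b c a))
     in (cmod a < 1 \<and> cmod b < 1 \<and> cmod c < 1 \<and> cmod d < 1 \<longrightarrow> aw_moment q a b c d n = \<mu>) \<and>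
        (\<forall>\<gamma>. aw_contour q a b c d \<gamma> \<longrightarrow> aw_contour_moment \<gamma> q a b c d n = \<mu>)"
proof -
  have q': "q \<noteq> 0" "norm q < 1" using q by auto
  define \<mu> where "\<mu> = qpochs_inf [a * b, a * c, a * d, b * c, b * d, c * d] q
               / (2 ^ (n + 1) * qpoch_inf (a * b * c * d) q) *
             (\<Sum>k=0..n. of_nat (n choose k) *
               (aw_F q n k a b c d + aw_F q n k b a c d + aw_F q n k c b a d + aw_F q n k d b c a))"
  have main: "aw_contour_moment \<gamma> q a b c d n = \<mu>" if \<gamma>: "aw_contour q a b c d \<gamma>" for \<gamma>
  proof -
    from aw_loop_of_aw_contour[OF q' nonzero ratios \<gamma>]
    interpret aw_loop q "{a, b, c, d}" \<gamma> by simp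
    have dist: "distinct [a, b, c, d]"
      using aw_loop_of_aw_contour[OF q' nonzero ratios \<gamma>] by simp
    define S where "S = (\<Sum>k\<le>n. of_nat (n choose k) *
        (\<Sum>e\<in>{a, b, c, d}. residue_sum (absdiff n k) e))"
    have prodE: "\<Prod>{a, b, c, d} = a * b * c * d" using dist by (simp add: mult_ac)
    have weight: "aw_weight q a b c d z = weight q {a, b, c, d} z" for z
      using dist by (simp add: aw_weight_def weight_def qpochs_inf_def mult_ac)
    have "aw_F q n k a b c d + aw_F q n k b a c d + aw_F q n k c b a d + aw_F q n k d b c a =
        qpoch_inf q q * (\<Sum>e\<in>{a, b, c, d}. residue_sum (absdiff n k) e)" for k
    proof -
      have "aw_F q n k a b c d = qpoch_inf q q * residue_sum (absdiff n k) a"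
           "aw_F q n k b a c d = qpoch_inf q q * residue_sum (absdiff n k) b"
           "aw_F q n k c b a d = qpoch_inf q q * residue_sum (absdiff n k) c"
           "aw_F q n k d b c a = qpoch_inf q q * residue_sum (absdiff n k) d"
        by (rule aw_F_eq_residue_sum; use dist in auto)+
      then show ?thesis
        using dist by (simp add: distrib_left add_ac)
    qed
    then have "\<mu> = qpochs_inf [a * b, a * c, a * d, b * c, b * d, c * d] q
        / (2 ^ (n + 1) * qpoch_inf (a * b * c * d) q) * (qpoch_inf q q * S)"
      unfolding \<mu>_def S_def by (simp add: atMost_atLeast0 sum_distrib_left mult_ac)
    moreover have "contour_integral \<gamma> (\<lambda>z. aw_weight q a b c d z * ((z + 1 / z) / 2) ^ n / (\<i> * z)) =
        2 * pi / 2 ^ n * S"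
      unfolding weight S_def
      by (rule contour_integral_moment) (use convergence in \<open>simp add: prodE\<close>)
    ultimately show ?thesis
      unfolding aw_contour_moment_def aw_const_def by (simp add: qpochs_inf_def mult_ac)
  qed
  have "aw_moment q a b c d n = \<mu>" if "cmod a < 1 \<and> cmod b < 1 \<and> cmod c < 1 \<and> cmod d < 1"
    unfolding aw_moment_eq_contour_moment
    using that by (intro main circlepath_aw_contour q' nonzero) auto
  with main show ?thesis
    unfolding Let_def \<mu>_def[symmetric] by blast
qed

end
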